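(* Let $\mathcal{O}$ be a DG operad, $C$ an $\mathbb{S}$-module of complexes equipped with an $\mathbb{S}$-module strong deformation retraction onto $0$, i.e. with degree $-1$ $\mathbb{S}_n$-equivariant maps $h=h(n)\colon C(n)\to C(n)$ such that $dh+hd=1$, and let $\mathcal{P}=\mathcal{O}\amalg\mathcal{F}(C)$. Let $h_C$ be the homotopy on $\mathcal{P}$ described in the context. If $I\subset\mathcal{P}$ is a DG operadic ideal generated by a set $S$ of weight-homogeneous elements of positive weight such that $h_C(S)\subset I$, then the composite $$\mathcal{O}\hookrightarrow\mathcal{P}\twoheadrightarrow\mathcal{P}/I$$ of the inclusion of the first factor of the coproduct and the natural projection is a quasi-isomorphism $\mathcal{O}\to\mathcal{P}/I$.
   Context: We work over a field $k$ of characteristic zero; complexes are cochain complexes. Operads are symmetric DG operads, $\mathcal{F}$ is the free operad functor (left adjoint of the forgetful functor from DG operads to $\mathbb{S}$-modules of complexes), and $\amalg$ is the coproduct of DG operads. The operad $\mathcal{P}=\mathcal{O}\amalg\mathcal{F}(C)$ is weighted, with $\mathcal{O}$ in weight $0$ and $C$ in weight $1$. A DG operadic ideal is an operadic ideal closed under the differential; "generated as a DG operadic ideal by $S$" means it is the smallest such ideal containing $S$. A strong deformation retraction (SDR) of operads from $\mathcal{P}$ onto $\mathcal{O}$ consists of DG operad morphisms $i\colon\mathcal{O}\to\mathcal{P}$, $p\colon\mathcal{P}\to\mathcal{O}$ with $pi=1$, and degree $-1$ $\mathbb{S}_n$-equivariant maps $h_C\colon\mathcal{P}(n)\to\mathcal{P}(n)$,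 $n\ge 0$, with $dh_C+h_Cd=1-ip$. The homotopy $h_C$ in the claim is that of the unique SDR of operads such that: $i$ is the inclusion of the first factor of the coproduct; $p$ is the retraction mapping positive weight elements to zero; $h_Ci=0$; the restriction of $h_C$ to $C$ is $h$; and, if $x,y\in\mathcal{P}$ have weights $v$ and $w$, then $$h_C(x\circ_iy)=\frac{v}{v+w}h_C(x)\circ_iy+(-1)^{|x|}\frac{w}{v+w}x\circ_ih_C(y),$$ where $\frac00$ is understood as $1$. *)

theory Defs
  imports "HOL-Algebra.Module" "HOL-Algebra.AbelCoset" "HOL-Combinatorics.Permutations"
begin

section \<open>Linear algebra over a field, in the style of HOL-Algebra\<close>

definition linear_maps ::
  "('k, 'r) ring_scheme \<Rightarrow> ('k, 'a, 'm) module_scheme \<Rightarrow> ('k, 'b, 'n) module_scheme \<Rightarrow> ('a \<Rightarrow> 'b) set"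
  where "linear_maps K V W = {f \<in> carrier V \<rightarrow> carrier W.
    (\<forall>x \<in> carrier V. \<forall>y \<in> carrier V. f (x \<oplus>\<^bsub>V\<^esub> y) = f x \<oplus>\<^bsub>W\<^esub> f y) \<and>
    (\<forall>c \<in> carrier K. \<forall>x \<in> carrier V. f (c \<odot>\<^bsub>V\<^esub> x) = c \<odot>\<^bsub>W\<^esub> f x)}"

text \<open>The fields \<open>mult\<close> and \<open>one\<close> of a module record are irrelevant to its module structure.\<close>

definition quot_module :: "('k, 'a, 'm) module_scheme \<Rightarrow> 'a set \<Rightarrow> ('k, 'a set) module"
  where "quot_module V H =
    \<lparr>carrier = a_rcosets\<^bsub>V\<^esub> H, monoid.mult = undefined, one = undefined, zero = H, add = set_add V,
     smult = (\<lambda>c X. \<Union>x\<in>X. H +>\<^bsub>V\<^esub> (c \<odot>\<^bsub>V\<^esub> x))\<rparr>"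

definition ksign :: "('k, 'r) ring_scheme \<Rightarrow> int \<Rightarrow> 'k"
  where "ksign K a = (if even a then \<one>\<^bsub>K\<^esub> else \<ominus>\<^bsub>K\<^esub> \<one>\<^bsub>K\<^esub>)"


section \<open>\<open>\<S>\<close>-modules of cochain complexes\<close>

text \<open>
  \<open>piece M n d\<close> is the degree \<open>d\<close> part of the complex \<open>M(n)\<close>; in particular all elements are
  homogeneous with respect to the degree.  Carriers of different pieces are allowed to overlap, so
  every operation takes the arity and the degree of its arguments as parameters.
  The symmetric group on \<open>n\<close> letters consists of the \<open>\<sigma>\<close> with \<open>\<sigma> permutes {1..n}\<close> and acts from
  the right: \<open>act M n d \<sigma> x\<close> is \<open>x \<cdot> \<sigma>\<close>.
\<close>

record ('k, 'a) smodule =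
  piece :: "nat \<Rightarrow> int \<Rightarrow> ('k, 'a) module"
  act :: "nat \<Rightarrow> int \<Rightarrow> (nat \<Rightarrow> nat) \<Rightarrow> 'a \<Rightarrow> 'a"
  diff :: "nat \<Rightarrow> int \<Rightarrow> 'a \<Rightarrow> 'a"

abbreviation elts :: "('k, 'a, 'm) smodule_scheme \<Rightarrow> nat \<Rightarrow> int \<Rightarrow> 'a set"
  where "elts M n d \<equiv> carrier (piece M n d)"

locale dg_smodule = field K for K :: "('k, 'r) ring_scheme" (structure) +
  fixes M :: "('k, 'a, 'm) smodule_scheme"
  assumes piece_module: "module K (piece M n d)"
    and act_linear: "\<sigma> permutes {1..n} \<Longrightarrow> act M n d \<sigma> \<in> linear_maps K (piece M n d) (piece M n d)"
    and act_id: "x \<in> elts M n d \<Longrightarrow> act M n d id x = x"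
    and act_act: "\<lbrakk>\<sigma> permutes {1..n}; \<tau> permutes {1..n}; x \<in> elts M n d\<rbrakk> \<Longrightarrow>
          act M n d \<tau> (act M n d \<sigma> x) = act M n d (\<sigma> \<circ> \<tau>) x"
    and diff_linear: "diff M n d \<in> linear_maps K (piece M n d) (piece M n (d + 1))"
    and diff_diff: "x \<in> elts M n d \<Longrightarrow> diff M n (d + 1) (diff M n d x) = \<zero>\<^bsub>piece M n (d + 2)\<^esub>"
    and diff_act: "\<lbrakk>\<sigma> permutes {1..n}; x \<in> elts M n d\<rbrakk> \<Longrightarrow>
          diff M n d (act M n d \<sigma> x) = act M n (d + 1) \<sigma> (diff M n d x)"

definition equivariant ::
  "('k, 'a, 'm) smodule_scheme \<Rightarrow> ('k, 'b, 'n) smodule_scheme \<Rightarrow> int \<Rightarrow> (nat \<Rightarrow> int \<Rightarrow> 'a \<Rightarrow> 'b) \<Rightarrow> bool"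
  \<comment> \<open>for a family of maps of degree \<open>e\<close>\<close>
  where "equivariant M N e f \<longleftrightarrow> (\<forall>n d \<sigma>. \<forall>x \<in> elts M n d. \<sigma> permutes {1..n} \<longrightarrow>
    f n d (act M n d \<sigma> x) = act N n (d + e) \<sigma> (f n d x))"

definition graded_maps :: "('k, 'r) ring_scheme \<Rightarrow> ('k, 'a, 'm) smodule_scheme \<Rightarrow>
    ('k, 'b, 'n) smodule_scheme \<Rightarrow> int \<Rightarrow> (nat \<Rightarrow> int \<Rightarrow> 'a \<Rightarrow> 'b) set"
  where "graded_maps K M N e = {f. (\<forall>n d. f n d \<in> linear_maps K (piece M n d) (piece N n (d + e))) \<and>
    equivariant M N e f}"

definition smodule_contraction :: "('k, 'r) ring_scheme \<Rightarrow> ('k, 'a, 'm) smodule_scheme \<Rightarrow>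
    (nat \<Rightarrow> int \<Rightarrow> 'a \<Rightarrow> 'a) \<Rightarrow> bool"
  \<comment> \<open>a strong deformation retraction onto \<open>0\<close>\<close>
  where "smodule_contraction K C h \<longleftrightarrow> h \<in> graded_maps K C C (-1) \<and>
    (\<forall>n d. \<forall>x \<in> elts C n d.
      diff C n (d - 1) (h n d x) \<oplus>\<^bsub>piece C n d\<^esub> h n (d + 1) (diff C n d x) = x)"


section \<open>Symmetric DG operads\<close>

text \<open>
  \<open>cmp P m a n b i x y\<close> is the partial composition \<open>x \<circ>\<^sub>i y\<close> for \<open>x\<close> of arity \<open>m\<close> and degree \<open>a\<close>
  and \<open>y\<close> of arity \<open>n\<close> and degree \<open>b\<close>.
\<close>

record ('k, 'a) operad = "('k, 'a) smodule" +
  unit :: 'a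
  cmp :: "nat \<Rightarrow> int \<Rightarrow> nat \<Rightarrow> int \<Rightarrow> nat \<Rightarrow> 'a \<Rightarrow> 'a \<Rightarrow> 'a"

text \<open>
  The permutation \<open>\<rho>\<close> of the inputs with \<open>(x \<cdot> \<sigma>) \<circ>\<^sub>i (y \<cdot> \<tau>) = (x \<circ>\<^bsub>\<sigma> i\<^esub> y) \<cdot> \<rho>\<close>, where \<open>n\<close> is
  the arity of \<open>y\<close>.  With a right action, the input \<open>k\<close> of \<open>x \<cdot> \<sigma>\<close> is fed into the slot \<open>\<sigma> k\<close> of
  \<open>x\<close>.  Outside \<open>{1..m + n - 1}\<close>, where \<open>m\<close> is the arity of \<open>x\<close>, this is the identity.
\<close>

definition perm_cmp :: "nat \<Rightarrow> nat \<Rightarrow> (nat \<Rightarrow> nat) \<Rightarrow> (nat \<Rightarrow> nat) \<Rightarrow> nat \<Rightarrow> nat"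
  where "perm_cmp n i \<sigma> \<tau> k =
    (let shift = (\<lambda>s. if s < \<sigma> i then s else s + n - 1)
     in if k < i then shift (\<sigma> k)
        else if k < i + n then \<sigma> i + \<tau> (k + 1 - i) - 1
        else shift (\<sigma> (k + 1 - n)))"

locale dg_operad = dg_smodule K P
  for K :: "('k, 'r) ring_scheme" (structure) and P :: "('k, 'a, 'm) operad_scheme" +
  assumes unit_closed: "unit P \<in> elts P 1 0"
    and cmp_linear_left: "\<lbrakk>1 \<le> i; i \<le> m; y \<in> elts P n b\<rbrakk> \<Longrightarrow>
          (\<lambda>x. cmp P m a n b i x y) \<in> linear_maps K (piece P m a) (piece P (m + n - 1) (a + b))"
    and cmp_linear_right: "\<lbrakk>1 \<le> i; i \<le> m; x \<in> elts P m a\<rbrakk> \<Longrightarrow>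
          cmp P m a n b i x \<in> linear_maps K (piece P n b) (piece P (m + n - 1) (a + b))"
    and unit_left: "y \<in> elts P n b \<Longrightarrow> cmp P 1 0 n b 1 (unit P) y = y"
    and unit_right: "\<lbrakk>1 \<le> i; i \<le> m; x \<in> elts P m a\<rbrakk> \<Longrightarrow> cmp P m a 1 0 i x (unit P) = x"
    and cmp_sequential:
        "\<lbrakk>1 \<le> i; i \<le> m; 1 \<le> j; j \<le> n; x \<in> elts P m a; y \<in> elts P n b; z \<in> elts P q c\<rbrakk> \<Longrightarrow>
          cmp P (m + n - 1) (a + b) q c (i + j - 1) (cmp P m a n b i x y) z =
          cmp P m a (n + q - 1) (b + c) i x (cmp P n b q c j y z)"
    and cmp_parallel:
        "\<lbrakk>1 \<le> i; i < k; k \<le> m; x \<in> elts P m a; y \<in> elts P n b; z \<in> elts P q c\<rbrakk> \<Longrightarrow>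
          cmp P (m + n - 1) (a + b) q c (k + n - 1) (cmp P m a n b i x y) z =
          ksign K (b * c) \<odot>\<^bsub>piece P (m + n + q - 2) (a + b + c)\<^esub>
            cmp P (m + q - 1) (a + c) n b i (cmp P m a q c k x z) y"
    and cmp_act:
        "\<lbrakk>1 \<le> i; i \<le> m; \<sigma> permutes {1..m}; \<tau> permutes {1..n}; x \<in> elts P m a; y \<in> elts P n b\<rbrakk> \<Longrightarrow>
          cmp P m a n b i (act P m a \<sigma> x) (act P n b \<tau> y) =
          act P (m + n - 1) (a + b) (perm_cmp n i \<sigma> \<tau>) (cmp P m a n b (\<sigma> i) x y)"
    and diff_cmp:
        "\<lbrakk>1 \<le> i; i \<le> m; x \<in> elts P m a; y \<in> elts P n b\<rbrakk> \<Longrightarrow>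
          diff P (m + n - 1) (a + b) (cmp P m a n b i x y) =
          cmp P m (a + 1) n b i (diff P m a x) y \<oplus>\<^bsub>piece P (m + n - 1) (a + b + 1)\<^esub>
          ksign K a \<odot>\<^bsub>piece P (m + n - 1) (a + b + 1)\<^esub> cmp P m a n (b + 1) i x (diff P n b y)"

definition dg_operad_hom :: "('k, 'r) ring_scheme \<Rightarrow> ('k, 'a, 'm) operad_scheme \<Rightarrow>
    ('k, 'b, 'n) operad_scheme \<Rightarrow> (nat \<Rightarrow> int \<Rightarrow> 'a \<Rightarrow> 'b) \<Rightarrow> bool"
  where "dg_operad_hom K A B f \<longleftrightarrow> f \<in> graded_maps K A B 0 \<and>
    (\<forall>n d. \<forall>x \<in> elts A n d. f n (d + 1) (diff A n d x) = diff B n d (f n d x)) \<and>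
    f 1 0 (unit A) = unit B \<and>
    (\<forall>m a n b i. \<forall>x \<in> elts A m a. \<forall>y \<in> elts A n b. 1 \<le> i \<and> i \<le> m \<longrightarrow>
      f (m + n - 1) (a + b) (cmp A m a n b i x y) = cmp B m a n b i (f m a x) (f n b y))"


section \<open>DG operads presented by generators and relations\<close>

datatype ('k, 'g) opterm =
    OGen nat int 'g
  | OUnit
  | OZero nat int
  | OAdd "('k, 'g) opterm" "('k, 'g) opterm"
  | OSmult 'k "('k, 'g) opterm"
  | OAct "nat \<Rightarrow> nat" "('k, 'g) opterm"
  | ODiff "('k, 'g) opterm"
  | OCmp nat "('k, 'g) opterm" "('k, 'g) opterm"

inductive wf_term :: "('k, 'r) ring_scheme \<Rightarrow> (nat \<Rightarrow> int \<Rightarrow> 'g set) \<Rightarrow> nat \<Rightarrow> int \<Rightarrow>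
    ('k, 'g) opterm \<Rightarrow> bool"
  for K :: "('k, 'r) ring_scheme" and G :: "nat \<Rightarrow> int \<Rightarrow> 'g set" where
  wf_gen: "g \<in> G n d \<Longrightarrow> wf_term K G n d (OGen n d g)"
| wf_unit: "wf_term K G 1 0 OUnit"
| wf_zero: "wf_term K G n d (OZero n d)"
| wf_add: "\<lbrakk>wf_term K G n d s; wf_term K G n d t\<rbrakk> \<Longrightarrow> wf_term K G n d (OAdd s t)"
| wf_smult: "\<lbrakk>c \<in> carrier K; wf_term K G n d t\<rbrakk> \<Longrightarrow> wf_term K G n d (OSmult c t)"
| wf_act: "\<lbrakk>\<sigma> permutes {1..n}; wf_term K G n d t\<rbrakk> \<Longrightarrow> wf_term K G n d (OAct \<sigma> t)"
| wf_diff: "wf_term K G n d t \<Longrightarrow> wf_term K G n (d + 1) (ODiff t)"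
| wf_cmp: "\<lbrakk>1 \<le> i; i \<le> m; wf_term K G m a s; wf_term K G n b t\<rbrakk> \<Longrightarrow>
    wf_term K G (m + n - 1) (a + b) (OCmp i s t)"

text \<open>
  The smallest congruence on well-formed terms which contains the relations \<open>R\<close> and satisfies the
  axioms of a DG operad.
\<close>

inductive op_eq :: "('k, 'r) ring_scheme \<Rightarrow> (nat \<Rightarrow> int \<Rightarrow> 'g set) \<Rightarrow>
    (nat \<Rightarrow> int \<Rightarrow> ('k, 'g) opterm \<Rightarrow> ('k, 'g) opterm \<Rightarrow> bool) \<Rightarrow>
    nat \<Rightarrow> int \<Rightarrow> ('k, 'g) opterm \<Rightarrow> ('k, 'g) opterm \<Rightarrow> bool"
  for K :: "('k, 'r) ring_scheme" and G :: "nat \<Rightarrow> int \<Rightarrow> 'g set"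
    and R :: "nat \<Rightarrow> int \<Rightarrow> ('k, 'g) opterm \<Rightarrow> ('k, 'g) opterm \<Rightarrow> bool" where
  oe_rel: "\<lbrakk>R n d s t; wf_term K G n d s; wf_term K G n d t\<rbrakk> \<Longrightarrow> op_eq K G R n d s t"
| oe_refl: "wf_term K G n d t \<Longrightarrow> op_eq K G R n d t t"
| oe_sym: "op_eq K G R n d s t \<Longrightarrow> op_eq K G R n d t s"
| oe_trans: "\<lbrakk>op_eq K G R n d s t; op_eq K G R n d t u\<rbrakk> \<Longrightarrow> op_eq K G R n d s u"
| oe_cong_add: "\<lbrakk>op_eq K G R n d s s'; op_eq K G R n d t t'\<rbrakk> \<Longrightarrow>
    op_eq K G R n d (OAdd s t) (OAdd s' t')"
| oe_cong_smult: "\<lbrakk>c \<in> carrier K; op_eq K G R n d t t'\<rbrakk> \<Longrightarrow>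
    op_eq K G R n d (OSmult c t) (OSmult c t')"
| oe_cong_act: "\<lbrakk>\<sigma> permutes {1..n}; op_eq K G R n d t t'\<rbrakk> \<Longrightarrow>
    op_eq K G R n d (OAct \<sigma> t) (OAct \<sigma> t')"
| oe_cong_diff: "op_eq K G R n d t t' \<Longrightarrow> op_eq K G R n (d + 1) (ODiff t) (ODiff t')"
| oe_cong_cmp: "\<lbrakk>1 \<le> i; i \<le> m; op_eq K G R m a s s'; op_eq K G R n b t t'\<rbrakk> \<Longrightarrow>
    op_eq K G R (m + n - 1) (a + b) (OCmp i s t) (OCmp i s' t')"
| oe_add_assoc: "\<lbrakk>wf_term K G n d s; wf_term K G n d t; wf_term K G n d u\<rbrakk> \<Longrightarrow>
    op_eq K G R n d (OAdd (OAdd s t) u) (OAdd s (OAdd t u))"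
| oe_add_comm: "\<lbrakk>wf_term K G n d s; wf_term K G n d t\<rbrakk> \<Longrightarrow>
    op_eq K G R n d (OAdd s t) (OAdd t s)"
| oe_add_zero: "wf_term K G n d t \<Longrightarrow> op_eq K G R n d (OAdd (OZero n d) t) t"
| oe_smult_zero: "wf_term K G n d t \<Longrightarrow> op_eq K G R n d (OSmult \<zero>\<^bsub>K\<^esub> t) (OZero n d)"
| oe_smult_one: "wf_term K G n d t \<Longrightarrow> op_eq K G R n d (OSmult \<one>\<^bsub>K\<^esub> t) t"
| oe_smult_smult: "\<lbrakk>c \<in> carrier K; e \<in> carrier K; wf_term K G n d t\<rbrakk> \<Longrightarrow>
    op_eq K G R n d (OSmult (c \<otimes>\<^bsub>K\<^esub> e) t) (OSmult c (OSmult e t))"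
| oe_smult_distr_left: "\<lbrakk>c \<in> carrier K; e \<in> carrier K; wf_term K G n d t\<rbrakk> \<Longrightarrow>
    op_eq K G R n d (OSmult (c \<oplus>\<^bsub>K\<^esub> e) t) (OAdd (OSmult c t) (OSmult e t))"
| oe_smult_distr_right: "\<lbrakk>c \<in> carrier K; wf_term K G n d s; wf_term K G n d t\<rbrakk> \<Longrightarrow>
    op_eq K G R n d (OSmult c (OAdd s t)) (OAdd (OSmult c s) (OSmult c t))"
| oe_act_add: "\<lbrakk>\<sigma> permutes {1..n}; wf_term K G n d s; wf_term K G n d t\<rbrakk> \<Longrightarrow>
    op_eq K G R n d (OAct \<sigma> (OAdd s t)) (OAdd (OAct \<sigma> s) (OAct \<sigma> t))"
| oe_act_smult: "\<lbrakk>\<sigma> permutes {1..n}; c \<in> carrier K; wf_term K G n d t\<rbrakk> \<Longrightarrow>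
    op_eq K G R n d (OAct \<sigma> (OSmult c t)) (OSmult c (OAct \<sigma> t))"
| oe_act_id: "wf_term K G n d t \<Longrightarrow> op_eq K G R n d (OAct id t) t"
| oe_act_act: "\<lbrakk>\<sigma> permutes {1..n}; \<tau> permutes {1..n}; wf_term K G n d t\<rbrakk> \<Longrightarrow>
    op_eq K G R n d (OAct \<tau> (OAct \<sigma> t)) (OAct (\<sigma> \<circ> \<tau>) t)"
| oe_diff_add: "\<lbrakk>wf_term K G n d s; wf_term K G n d t\<rbrakk> \<Longrightarrow>
    op_eq K G R n (d + 1) (ODiff (OAdd s t)) (OAdd (ODiff s) (ODiff t))"
| oe_diff_smult: "\<lbrakk>c \<in> carrier K; wf_term K G n d t\<rbrakk> \<Longrightarrow>
    op_eq K G R n (d + 1) (ODiff (OSmult c t)) (OSmult c (ODiff t))"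
| oe_diff_diff: "wf_term K G n d t \<Longrightarrow> op_eq K G R n (d + 2) (ODiff (ODiff t)) (OZero n (d + 2))"
| oe_diff_act: "\<lbrakk>\<sigma> permutes {1..n}; wf_term K G n d t\<rbrakk> \<Longrightarrow>
    op_eq K G R n (d + 1) (ODiff (OAct \<sigma> t)) (OAct \<sigma> (ODiff t))"
| oe_cmp_add_left: "\<lbrakk>1 \<le> i; i \<le> m; wf_term K G m a s; wf_term K G m a s'; wf_term K G n b t\<rbrakk> \<Longrightarrow>
    op_eq K G R (m + n - 1) (a + b) (OCmp i (OAdd s s') t) (OAdd (OCmp i s t) (OCmp i s' t))"
| oe_cmp_smult_left: "\<lbrakk>1 \<le> i; i \<le> m; c \<in> carrier K; wf_term K G m a s; wf_term K G n b t\<rbrakk> \<Longrightarrow>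
    op_eq K G R (m + n - 1) (a + b) (OCmp i (OSmult c s) t) (OSmult c (OCmp i s t))"
| oe_cmp_add_right: "\<lbrakk>1 \<le> i; i \<le> m; wf_term K G m a s; wf_term K G n b t; wf_term K G n b t'\<rbrakk> \<Longrightarrow>
    op_eq K G R (m + n - 1) (a + b) (OCmp i s (OAdd t t')) (OAdd (OCmp i s t) (OCmp i s t'))"
| oe_cmp_smult_right: "\<lbrakk>1 \<le> i; i \<le> m; c \<in> carrier K; wf_term K G m a s; wf_term K G n b t\<rbrakk> \<Longrightarrow>
    op_eq K G R (m + n - 1) (a + b) (OCmp i s (OSmult c t)) (OSmult c (OCmp i s t))"
| oe_unit_left: "wf_term K G n b t \<Longrightarrow> op_eq K G R n b (OCmp 1 OUnit t) t"
| oe_unit_right: "\<lbrakk>1 \<le> i; i \<le> m; wf_term K G m a s\<rbrakk> \<Longrightarrow> op_eq K G R m a (OCmp i s OUnit) s"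
| oe_cmp_sequential: "\<lbrakk>1 \<le> i; i \<le> m; 1 \<le> j; j \<le> n;
      wf_term K G m a s; wf_term K G n b t; wf_term K G q c u\<rbrakk> \<Longrightarrow>
    op_eq K G R (m + n + q - 2) (a + b + c)
      (OCmp (i + j - 1) (OCmp i s t) u) (OCmp i s (OCmp j t u))"
| oe_cmp_parallel: "\<lbrakk>1 \<le> i; i < k; k \<le> m;
      wf_term K G m a s; wf_term K G n b t; wf_term K G q c u\<rbrakk> \<Longrightarrow>
    op_eq K G R (m + n + q - 2) (a + b + c)
      (OCmp (k + n - 1) (OCmp i s t) u) (OSmult (ksign K (b * c)) (OCmp i (OCmp k s u) t))"
| oe_cmp_act: "\<lbrakk>1 \<le> i; i \<le> m; \<sigma> permutes {1..m}; \<tau> permutes {1..n};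
      wf_term K G m a s; wf_term K G n b t\<rbrakk> \<Longrightarrow>
    op_eq K G R (m + n - 1) (a + b)
      (OCmp i (OAct \<sigma> s) (OAct \<tau> t)) (OAct (perm_cmp n i \<sigma> \<tau>) (OCmp (\<sigma> i) s t))"
| oe_diff_cmp: "\<lbrakk>1 \<le> i; i \<le> m; wf_term K G m a s; wf_term K G n b t\<rbrakk> \<Longrightarrow>
    op_eq K G R (m + n - 1) (a + b + 1)
      (ODiff (OCmp i s t)) (OAdd (OCmp i (ODiff s) t) (OSmult (ksign K a) (OCmp i s (ODiff t))))"

definition term_class :: "('k, 'r) ring_scheme \<Rightarrow> (nat \<Rightarrow> int \<Rightarrow> 'g set) \<Rightarrow>
    (nat \<Rightarrow> int \<Rightarrow> ('k, 'g) opterm \<Rightarrow> ('k, 'g) opterm \<Rightarrow> bool) \<Rightarrow>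
    nat \<Rightarrow> int \<Rightarrow> ('k, 'g) opterm \<Rightarrow> ('k, 'g) opterm set"
  where "term_class K G R n d t = {s. op_eq K G R n d t s}"

definition presented_operad :: "('k, 'r) ring_scheme \<Rightarrow> (nat \<Rightarrow> int \<Rightarrow> 'g set) \<Rightarrow>
    (nat \<Rightarrow> int \<Rightarrow> ('k, 'g) opterm \<Rightarrow> ('k, 'g) opterm \<Rightarrow> bool) \<Rightarrow>
    ('k, ('k, 'g) opterm set) operad"
  where "presented_operad K G R =
    \<lparr>piece = (\<lambda>n d. \<lparr>carrier = term_class K G R n d ` {t. wf_term K G n d t},
        monoid.mult = undefined, one = undefined,
        zero = term_class K G R n d (OZero n d),
        add = (\<lambda>X Y. \<Union>s\<in>X. \<Union>t\<in>Y. term_class K G R n d (OAdd s t)),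
        smult = (\<lambda>c X. \<Union>t\<in>X. term_class K G R n d (OSmult c t))\<rparr>),
     act = (\<lambda>n d \<sigma> X. \<Union>t\<in>X. term_class K G R n d (OAct \<sigma> t)),
     diff = (\<lambda>n d X. \<Union>t\<in>X. term_class K G R n (d + 1) (ODiff t)),
     unit = term_class K G R 1 0 OUnit,
     cmp = (\<lambda>m a n b i X Y. \<Union>s\<in>X. \<Union>t\<in>Y. term_class K G R (m + n - 1) (a + b) (OCmp i s t))\<rparr>"

text \<open>Relations saying that \<open>x \<mapsto> OGen n d (\<iota> x)\<close> is a morphism of \<open>\<S>\<close>-modules of complexes.\<close>

inductive smodule_rels :: "('k, 'r) ring_scheme \<Rightarrow> ('k, 'a, 'm) smodule_scheme \<Rightarrow> ('a \<Rightarrow> 'g) \<Rightarrow>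
    nat \<Rightarrow> int \<Rightarrow> ('k, 'g) opterm \<Rightarrow> ('k, 'g) opterm \<Rightarrow> bool"
  for K :: "('k, 'r) ring_scheme" and M :: "('k, 'a, 'm) smodule_scheme" and \<iota> :: "'a \<Rightarrow> 'g" where
  "\<lbrakk>x \<in> elts M n d; y \<in> elts M n d\<rbrakk> \<Longrightarrow> smodule_rels K M \<iota> n d
    (OGen n d (\<iota> (x \<oplus>\<^bsub>piece M n d\<^esub> y))) (OAdd (OGen n d (\<iota> x)) (OGen n d (\<iota> y)))"
| "\<lbrakk>c \<in> carrier K; x \<in> elts M n d\<rbrakk> \<Longrightarrow> smodule_rels K M \<iota> n d
    (OGen n d (\<iota> (c \<odot>\<^bsub>piece M n d\<^esub> x))) (OSmult c (OGen n d (\<iota> x)))"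
| "\<lbrakk>\<sigma> permutes {1..n}; x \<in> elts M n d\<rbrakk> \<Longrightarrow> smodule_rels K M \<iota> n d
    (OGen n d (\<iota> (act M n d \<sigma> x))) (OAct \<sigma> (OGen n d (\<iota> x)))"
| "x \<in> elts M n d \<Longrightarrow> smodule_rels K M \<iota> n (d + 1)
    (OGen n (d + 1) (\<iota> (diff M n d x))) (ODiff (OGen n d (\<iota> x)))"

text \<open>Relations saying that \<open>x \<mapsto> OGen n d (\<iota> x)\<close> is a morphism of DG operads.\<close>

inductive operad_rels :: "('k, 'r) ring_scheme \<Rightarrow> ('k, 'a, 'm) operad_scheme \<Rightarrow> ('a \<Rightarrow> 'g) \<Rightarrow>
    nat \<Rightarrow> int \<Rightarrow> ('k, 'g) opterm \<Rightarrow> ('k, 'g) opterm \<Rightarrow> bool"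
  for K :: "('k, 'r) ring_scheme" and A :: "('k, 'a, 'm) operad_scheme" and \<iota> :: "'a \<Rightarrow> 'g" where
  "smodule_rels K A \<iota> n d s t \<Longrightarrow> operad_rels K A \<iota> n d s t"
| "operad_rels K A \<iota> 1 0 (OGen 1 0 (\<iota> (unit A))) OUnit"
| "\<lbrakk>1 \<le> i; i \<le> m; x \<in> elts A m a; y \<in> elts A n b\<rbrakk> \<Longrightarrow> operad_rels K A \<iota> (m + n - 1) (a + b)
    (OGen (m + n - 1) (a + b) (\<iota> (cmp A m a n b i x y))) (OCmp i (OGen m a (\<iota> x)) (OGen n b (\<iota> y)))"

definition free_operad :: "('k, 'r) ring_scheme \<Rightarrow> ('k, 'c, 'm) smodule_scheme \<Rightarrow>
    ('k, ('k, 'c) opterm set) operad"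
  where "free_operad K C = presented_operad K (elts C) (smodule_rels K C id)"

definition free_gen :: "('k, 'r) ring_scheme \<Rightarrow> ('k, 'c, 'm) smodule_scheme \<Rightarrow>
    nat \<Rightarrow> int \<Rightarrow> 'c \<Rightarrow> ('k, 'c) opterm set"
  where "free_gen K C n d x = term_class K (elts C) (smodule_rels K C id) n d (OGen n d x)"

definition coprod_gens :: "('k, 'a, 'm) operad_scheme \<Rightarrow> ('k, 'b, 'n) operad_scheme \<Rightarrow>
    nat \<Rightarrow> int \<Rightarrow> ('a + 'b) set"
  where "coprod_gens A B n d = Inl ` elts A n d \<union> Inr ` elts B n d"

definition coprod_rels :: "('k, 'r) ring_scheme \<Rightarrow> ('k, 'a, 'm) operad_scheme \<Rightarrow>
    ('k, 'b, 'n) operad_scheme \<Rightarrow> nat \<Rightarrow> int \<Rightarrow> ('k, 'a + 'b) opterm \<Rightarrow> ('k, 'a + 'b) opterm \<Rightarrow> bool"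
  where "coprod_rels K A B n d s t \<longleftrightarrow> operad_rels K A Inl n d s t \<or> operad_rels K B Inr n d s t"

definition operad_coprod :: "('k, 'r) ring_scheme \<Rightarrow> ('k, 'a, 'm) operad_scheme \<Rightarrow>
    ('k, 'b, 'n) operad_scheme \<Rightarrow> ('k, ('k, 'a + 'b) opterm set) operad"
  where "operad_coprod K A B = presented_operad K (coprod_gens A B) (coprod_rels K A B)"

definition coprod_inl :: "('k, 'r) ring_scheme \<Rightarrow> ('k, 'a, 'm) operad_scheme \<Rightarrow>
    ('k, 'b, 'n) operad_scheme \<Rightarrow> nat \<Rightarrow> int \<Rightarrow> 'a \<Rightarrow> ('k, 'a + 'b) opterm set"
  where "coprod_inl K A B n d x = term_class K (coprod_gens A B) (coprod_rels K A B) n d (OGen n d (Inl x))"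

definition coprod_inr :: "('k, 'r) ring_scheme \<Rightarrow> ('k, 'a, 'm) operad_scheme \<Rightarrow>
    ('k, 'b, 'n) operad_scheme \<Rightarrow> nat \<Rightarrow> int \<Rightarrow> 'b \<Rightarrow> ('k, 'a + 'b) opterm set"
  where "coprod_inr K A B n d y = term_class K (coprod_gens A B) (coprod_rels K A B) n d (OGen n d (Inr y))"


section \<open>Ideals and quotients\<close>

definition dg_operadic_ideal :: "('k, 'r) ring_scheme \<Rightarrow> ('k, 'a, 'm) operad_scheme \<Rightarrow>
    (nat \<Rightarrow> int \<Rightarrow> 'a set) \<Rightarrow> bool"
  where "dg_operadic_ideal K P I \<longleftrightarrow>
    (\<forall>n d. submodule (I n d) K (piece P n d)) \<and>
    (\<forall>n d \<sigma>. \<forall>x \<in> I n d. \<sigma> permutes {1..n} \<longrightarrow> act P n d \<sigma> x \<in> I n d) \<and>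
    (\<forall>m a n b i. \<forall>x \<in> I m a. \<forall>y \<in> elts P n b. 1 \<le> i \<and> i \<le> m \<longrightarrow>
      cmp P m a n b i x y \<in> I (m + n - 1) (a + b)) \<and>
    (\<forall>m a n b i. \<forall>x \<in> elts P m a. \<forall>y \<in> I n b. 1 \<le> i \<and> i \<le> m \<longrightarrow>
      cmp P m a n b i x y \<in> I (m + n - 1) (a + b)) \<and>
    (\<forall>n d. \<forall>x \<in> I n d. diff P n d x \<in> I n (d + 1))"

definition generated_dg_ideal :: "('k, 'r) ring_scheme \<Rightarrow> ('k, 'a, 'm) operad_scheme \<Rightarrow>
    (nat \<Rightarrow> int \<Rightarrow> 'a set) \<Rightarrow> nat \<Rightarrow> int \<Rightarrow> 'a set"
  where "generated_dg_ideal K P S n d =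
    \<Inter>{J n d | J. dg_operadic_ideal K P J \<and> (\<forall>m e. S m e \<subseteq> J m e)}"

definition quot_proj :: "('k, 'a, 'm) operad_scheme \<Rightarrow> (nat \<Rightarrow> int \<Rightarrow> 'a set) \<Rightarrow>
    nat \<Rightarrow> int \<Rightarrow> 'a \<Rightarrow> 'a set"
  where "quot_proj P I n d x = I n d +>\<^bsub>piece P n d\<^esub> x"

definition quot_operad :: "('k, 'a, 'm) operad_scheme \<Rightarrow> (nat \<Rightarrow> int \<Rightarrow> 'a set) \<Rightarrow>
    ('k, 'a set) operad"
  where "quot_operad P I =
    \<lparr>piece = (\<lambda>n d. quot_module (piece P n d) (I n d)),
     act = (\<lambda>n d \<sigma> X. \<Union>x\<in>X. quot_proj P I n d (act P n d \<sigma> x)),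
     diff = (\<lambda>n d X. \<Union>x\<in>X. quot_proj P I n (d + 1) (diff P n d x)),
     unit = quot_proj P I 1 0 (unit P),
     cmp = (\<lambda>m a n b i X Y. \<Union>x\<in>X. \<Union>y\<in>Y. quot_proj P I (m + n - 1) (a + b) (cmp P m a n b i x y))\<rparr>"


section \<open>Cohomology and quasi-isomorphisms\<close>

definition cocycles :: "('k, 'a, 'm) smodule_scheme \<Rightarrow> nat \<Rightarrow> int \<Rightarrow> 'a set"
  where "cocycles M n d = {x \<in> elts M n d. diff M n d x = \<zero>\<^bsub>piece M n (d + 1)\<^esub>}"

definition coboundaries :: "('k, 'a, 'm) smodule_scheme \<Rightarrow> nat \<Rightarrow> int \<Rightarrow> 'a set"
  where "coboundaries M n d = diff M n (d - 1) ` elts M n (d - 1)"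

definition cohomology :: "('k, 'a, 'm) smodule_scheme \<Rightarrow> nat \<Rightarrow> int \<Rightarrow> ('k, 'a set) module"
  where "cohomology M n d =
    quot_module ((piece M n d)\<lparr>carrier := cocycles M n d\<rparr>) (coboundaries M n d)"

definition cohomology_map :: "('k, 'b, 'n) smodule_scheme \<Rightarrow> (nat \<Rightarrow> int \<Rightarrow> 'a \<Rightarrow> 'b) \<Rightarrow>
    nat \<Rightarrow> int \<Rightarrow> 'a set \<Rightarrow> 'b set"
  where "cohomology_map N f n d X = (\<Union>x\<in>X. coboundaries N n d +>\<^bsub>piece N n d\<^esub> f n d x)"

definition operad_quasi_iso :: "('k, 'r) ring_scheme \<Rightarrow> ('k, 'a, 'm) operad_scheme \<Rightarrow>
    ('k, 'b, 'n) operad_scheme \<Rightarrow> (nat \<Rightarrow> int \<Rightarrow> 'a \<Rightarrow> 'b) \<Rightarrow> bool"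
  where "operad_quasi_iso K A B f \<longleftrightarrow> dg_operad K A \<and> dg_operad K B \<and> dg_operad_hom K A B f \<and>
    (\<forall>n d. cohomology_map B f n d \<in> linear_maps K (cohomology A n d) (cohomology B n d) \<and>
      bij_betw (cohomology_map B f n d) (carrier (cohomology A n d)) (carrier (cohomology B n d)))"


section \<open>The operad \<open>\<O> \<amalg> \<F>(C)\<close>, its weight grading and its homotopy\<close>

definition adjoin :: "('k, 'r) ring_scheme \<Rightarrow> ('k, 'o, 'm) operad_scheme \<Rightarrow>
    ('k, 'c, 'n) smodule_scheme \<Rightarrow> ('k, ('k, 'o + ('k, 'c) opterm set) opterm set) operad"
  where "adjoin K Op C = operad_coprod K Op (free_operad K C)"

definition adjoin_inl :: "('k, 'r) ring_scheme \<Rightarrow> ('k, 'o, 'm) operad_scheme \<Rightarrow>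
    ('k, 'c, 'n) smodule_scheme \<Rightarrow> nat \<Rightarrow> int \<Rightarrow> 'o \<Rightarrow> ('k, 'o + ('k, 'c) opterm set) opterm set"
  where "adjoin_inl K Op C = coprod_inl K Op (free_operad K C)"

definition adjoin_gen :: "('k, 'r) ring_scheme \<Rightarrow> ('k, 'o, 'm) operad_scheme \<Rightarrow>
    ('k, 'c, 'n) smodule_scheme \<Rightarrow> nat \<Rightarrow> int \<Rightarrow> 'c \<Rightarrow> ('k, 'o + ('k, 'c) opterm set) opterm set"
  where "adjoin_gen K Op C n d x = coprod_inr K Op (free_operad K C) n d (free_gen K C n d x)"

text \<open>\<open>has_weight K Op C w n d x\<close>: the element \<open>x\<close> of arity \<open>n\<close> and degree \<open>d\<close> is homogeneous of
  weight \<open>w\<close>.  The zero element is homogeneous of every weight.\<close>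

inductive has_weight :: "('k, 'r) ring_scheme \<Rightarrow> ('k, 'o, 'm) operad_scheme \<Rightarrow>
    ('k, 'c, 'n) smodule_scheme \<Rightarrow> nat \<Rightarrow> nat \<Rightarrow> int \<Rightarrow>
    ('k, 'o + ('k, 'c) opterm set) opterm set \<Rightarrow> bool"
  for K :: "('k, 'r) ring_scheme" and Op :: "('k, 'o, 'm) operad_scheme"
    and C :: "('k, 'c, 'n) smodule_scheme" where
  weight_inl: "x \<in> elts Op n d \<Longrightarrow> has_weight K Op C 0 n d (adjoin_inl K Op C n d x)"
| weight_gen: "x \<in> elts C n d \<Longrightarrow> has_weight K Op C 1 n d (adjoin_gen K Op C n d x)"
| weight_zero: "has_weight K Op C w n d \<zero>\<^bsub>piece (adjoin K Op C) n d\<^esub>"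
| weight_add: "\<lbrakk>has_weight K Op C w n d x; has_weight K Op C w n d y\<rbrakk> \<Longrightarrow>
    has_weight K Op C w n d (x \<oplus>\<^bsub>piece (adjoin K Op C) n d\<^esub> y)"
| weight_smult: "\<lbrakk>c \<in> carrier K; has_weight K Op C w n d x\<rbrakk> \<Longrightarrow>
    has_weight K Op C w n d (c \<odot>\<^bsub>piece (adjoin K Op C) n d\<^esub> x)"
| weight_act: "\<lbrakk>\<sigma> permutes {1..n}; has_weight K Op C w n d x\<rbrakk> \<Longrightarrow>
    has_weight K Op C w n d (act (adjoin K Op C) n d \<sigma> x)"
| weight_cmp: "\<lbrakk>1 \<le> i; i \<le> m; has_weight K Op C v m a x; has_weight K Op C w n b y\<rbrakk> \<Longrightarrow>
    has_weight K Op C (v + w) (m + n - 1) (a + b) (cmp (adjoin K Op C) m a n b i x y)"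

definition operad_sdr :: "('k, 'r) ring_scheme \<Rightarrow> ('k, 'a, 'm) operad_scheme \<Rightarrow>
    ('k, 'b, 'n) operad_scheme \<Rightarrow> (nat \<Rightarrow> int \<Rightarrow> 'b \<Rightarrow> 'a) \<Rightarrow> (nat \<Rightarrow> int \<Rightarrow> 'a \<Rightarrow> 'b) \<Rightarrow>
    (nat \<Rightarrow> int \<Rightarrow> 'a \<Rightarrow> 'a) \<Rightarrow> bool"
  where "operad_sdr K P A i p H \<longleftrightarrow> dg_operad_hom K A P i \<and> dg_operad_hom K P A p \<and>
    (\<forall>n d. \<forall>x \<in> elts A n d. p n d (i n d x) = x) \<and>
    H \<in> graded_maps K P P (-1) \<and>
    (\<forall>n d. \<forall>x \<in> elts P n d.
      diff P n (d - 1) (H n d x) \<oplus>\<^bsub>piece P n d\<^esub> H n (d + 1) (diff P n d x) =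
      x \<ominus>\<^bsub>piece P n d\<^esub> i n d (p n d x))"

definition weight_ratio :: "('k, 'r) ring_scheme \<Rightarrow> nat \<Rightarrow> nat \<Rightarrow> 'k"
  \<comment> \<open>the fraction \<open>v / t\<close> in \<open>K\<close>, where \<open>0 / 0\<close> is understood as \<open>1\<close>\<close>
  where "weight_ratio K v t = (if t = 0 then \<one>\<^bsub>K\<^esub>
    else add_pow K v \<one>\<^bsub>K\<^esub> \<otimes>\<^bsub>K\<^esub> inv\<^bsub>K\<^esub> (add_pow K t \<one>\<^bsub>K\<^esub>))"

definition adjoin_sdr :: "('k, 'r) ring_scheme \<Rightarrow> ('k, 'o, 'm) operad_scheme \<Rightarrow>
    ('k, 'c, 'n) smodule_scheme \<Rightarrow> (nat \<Rightarrow> int \<Rightarrow> 'c \<Rightarrow> 'c) \<Rightarrow>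
    (nat \<Rightarrow> int \<Rightarrow> ('k, 'o + ('k, 'c) opterm set) opterm set \<Rightarrow> 'o) \<Rightarrow>
    (nat \<Rightarrow> int \<Rightarrow> ('k, 'o + ('k, 'c) opterm set) opterm set \<Rightarrow>
      ('k, 'o + ('k, 'c) opterm set) opterm set) \<Rightarrow> bool"
  where "adjoin_sdr K Op C h p H \<longleftrightarrow>
    operad_sdr K (adjoin K Op C) Op (adjoin_inl K Op C) p H \<and>
    (\<forall>w n d x. has_weight K Op C w n d x \<and> w > 0 \<longrightarrow> p n d x = \<zero>\<^bsub>piece Op n d\<^esub>) \<and>
    (\<forall>n d. \<forall>x \<in> elts Op n d. H n d (adjoin_inl K Op C n d x) = \<zero>\<^bsub>piece (adjoin K Op C) n (d - 1)\<^esub>) \<and>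
    (\<forall>n d. \<forall>x \<in> elts C n d. H n d (adjoin_gen K Op C n d x) = adjoin_gen K Op C n (d - 1) (h n d x)) \<and>
    (\<forall>v w m a n b i x y. has_weight K Op C v m a x \<and> has_weight K Op C w n b y \<and> 1 \<le> i \<and> i \<le> m \<longrightarrow>
      (let P = adjoin K Op C; V = piece P (m + n - 1) (a + b - 1) in
        H (m + n - 1) (a + b) (cmp P m a n b i x y) =
        weight_ratio K v (v + w) \<odot>\<^bsub>V\<^esub> cmp P m (a - 1) n b i (H m a x) y \<oplus>\<^bsub>V\<^esub>
        (ksign K a \<otimes>\<^bsub>K\<^esub> weight_ratio K w (v + w)) \<odot>\<^bsub>V\<^esub> cmp P m a n (b - 1) i x (H n b y)))"

end

theory Submission
  imports Defs "HOL-Algebra.Generated_Groups"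
begin

text \<open>
  If the homotopy \<open>hC\<close> maps the ideal \<open>I\<close> to itself and the retraction \<open>p\<close> vanishes on \<open>I\<close>, then the
  deformation retraction of \<open>P\<close> onto \<open>Op\<close> induces one of \<open>P/I\<close> onto \<open>Op\<close>, and the theorem follows
  (\<open>sdr_quotient_quasi_iso\<close>).  The retraction vanishes on \<open>I\<close> because its kernel is a DG ideal that
  contains all homogeneous elements of positive weight (\<open>retraction_vanishes_on_ideal\<close>).

  Only the generators are known to be mapped into \<open>I\<close> by \<open>hC\<close>.  To propagate this to \<open>I\<close>, consider the
  span \<open>J\<close> of the homogeneous elements \<open>x\<close> of positive weight with both \<open>x\<close> and \<open>hC x\<close> in \<open>I\<close>.  The
  equation \<open>hC (d x) = x - i (p x) - d (hC x)\<close>, in which \<open>p x = 0\<close>, shows that \<open>J\<close> is closed under the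
  differential.  The formula for \<open>hC\<close> on a composition \<open>x \<circ>\<^sub>i y\<close> of homogeneous elements expresses it by
  \<open>hC x \<circ>\<^sub>i y\<close> and \<open>x \<circ>\<^sub>i hC y\<close>, and both lie in \<open>I\<close> as soon as one factor is among the generators of
  \<open>J\<close>.  So \<open>J\<close> is a DG ideal between the generators and \<open>I\<close>, and \<open>J = I\<close>
  (\<open>homotopy_preserves_ideal\<close>).

  The last step composes with arbitrary elements of \<open>P\<close>, so it needs that \<open>P\<close> is spanned by homogeneous
  elements (\<open>homogeneous_span\<close>), and the closure under \<open>d\<close> needs that \<open>d\<close> preserves weights
  (\<open>weight_diff\<close>).  As \<open>P\<close> consists of classes of terms, these facts rest on the verification that
  generators and relations present a DG operad (\<open>presented_dg_operad\<close>) in which every sub-DG-operad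
  that contains the generators is everything (\<open>presented_operad_generated\<close>).
\<close>

section \<open>Linear maps and quotient modules\<close>

lemma linear_mapsI:
  assumes "\<And>x. x \<in> carrier V \<Longrightarrow> f x \<in> carrier W"
    and "\<And>x y. \<lbrakk>x \<in> carrier V; y \<in> carrier V\<rbrakk> \<Longrightarrow> f (x \<oplus>\<^bsub>V\<^esub> y) = f x \<oplus>\<^bsub>W\<^esub> f y"
    and "\<And>c x. \<lbrakk>c \<in> carrier K; x \<in> carrier V\<rbrakk> \<Longrightarrow> f (c \<odot>\<^bsub>V\<^esub> x) = c \<odot>\<^bsub>W\<^esub> f x"
  shows "f \<in> linear_maps K V W"
  using assms by (auto simp: linear_maps_def)

lemma linear_maps_closed: "f \<in> linear_maps K V W \<Longrightarrow> x \<in> carrier V \<Longrightarrow> f x \<in> carrier W"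
  and linear_maps_add: "f \<in> linear_maps K V W \<Longrightarrow> x \<in> carrier V \<Longrightarrow> y \<in> carrier V \<Longrightarrow>
    f (x \<oplus>\<^bsub>V\<^esub> y) = f x \<oplus>\<^bsub>W\<^esub> f y"
  and linear_maps_smult: "f \<in> linear_maps K V W \<Longrightarrow> c \<in> carrier K \<Longrightarrow> x \<in> carrier V \<Longrightarrow>
    f (c \<odot>\<^bsub>V\<^esub> x) = c \<odot>\<^bsub>W\<^esub> f x"
  by (auto simp: linear_maps_def)

lemma linear_maps_comp:
  assumes "f \<in> linear_maps K U V" and "g \<in> linear_maps K V W"
  shows "(\<lambda>x. g (f x)) \<in> linear_maps K U W"
  using assms by (auto simp: linear_maps_def Pi_iff)

lemma linear_maps_zero:
  assumes "module K V" and "module K W" and f: "f \<in> linear_maps K V W"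
  shows "f \<zero>\<^bsub>V\<^esub> = \<zero>\<^bsub>W\<^esub>"
proof -
  interpret V: module K V by fact
  interpret W: module K W by fact
  have "f (\<zero>\<^bsub>K\<^esub> \<odot>\<^bsub>V\<^esub> \<zero>\<^bsub>V\<^esub>) = \<zero>\<^bsub>K\<^esub> \<odot>\<^bsub>W\<^esub> f \<zero>\<^bsub>V\<^esub>"
    by (intro linear_maps_smult[OF f]) auto
  then show ?thesis
    using linear_maps_closed[OF f] by simp
qed

lemma linear_maps_uminus:
  assumes "module K V" and "module K W" and f: "f \<in> linear_maps K V W" and x: "x \<in> carrier V"
  shows "f (\<ominus>\<^bsub>V\<^esub> x) = \<ominus>\<^bsub>W\<^esub> f x"
proof -
  interpret V: module K V by fact
  interpret W: module K W by fact
  have "f ((\<ominus>\<^bsub>K\<^esub> \<one>\<^bsub>K\<^esub>) \<odot>\<^bsub>V\<^esub> x) = (\<ominus>\<^bsub>K\<^esub> \<one>\<^bsub>K\<^esub>) \<odot>\<^bsub>W\<^esub> f x"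
    using x by (intro linear_maps_smult[OF f]) auto
  then show ?thesis
    using linear_maps_closed[OF f x] x by (simp add: V.smult_l_minus W.smult_l_minus)
qed

lemma module_minus_zero:
  assumes "module K V" and "x \<in> carrier V"
  shows "x \<ominus>\<^bsub>V\<^esub> \<zero>\<^bsub>V\<^esub> = x"
proof -
  interpret V: module K V by fact
  show ?thesis
    using assms(2) V.M.r_neg[of "\<zero>\<^bsub>V\<^esub>"] by (simp add: a_minus_def)
qed

lemma module_minus_eq_zeroD:
  assumes "module K V" and "x \<ominus>\<^bsub>V\<^esub> y = \<zero>\<^bsub>V\<^esub>" and "x \<in> carrier V" and "y \<in> carrier V"
  shows "x = y"
proof -
  interpret V: module K V by fact
  have "\<ominus>\<^bsub>V\<^esub> (\<ominus>\<^bsub>V\<^esub> y) = x"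
    using assms by (intro V.M.minus_equality) (auto simp: a_minus_def)
  then show ?thesis using assms by simp
qed

lemma module_add_minus_cancel:
  assumes "module K V" and "x \<in> carrier V" and "y \<in> carrier V"
  shows "(x \<oplus>\<^bsub>V\<^esub> y) \<ominus>\<^bsub>V\<^esub> x = y"
proof -
  interpret V: module K V by fact
  have "(x \<oplus>\<^bsub>V\<^esub> y) \<ominus>\<^bsub>V\<^esub> x = x \<oplus>\<^bsub>V\<^esub> (\<ominus>\<^bsub>V\<^esub> x \<oplus>\<^bsub>V\<^esub> y)"
    using assms by (simp add: a_minus_def V.M.a_ac)
  then show ?thesis using assms by (simp add: V.M.r_neg2)
qed

lemma linear_maps_minus:
  assumes V: "module K V" and W: "module K W" and f: "f \<in> linear_maps K V W"
    and x: "x \<in> carrier V" and y: "y \<in> carrier V"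
  shows "f (x \<ominus>\<^bsub>V\<^esub> y) = f x \<ominus>\<^bsub>W\<^esub> f y"
proof -
  interpret V: module K V by fact
  show ?thesis
    using x y by (simp add: a_minus_def linear_maps_add[OF f] linear_maps_uminus[OF V W f])
qed

lemma submodule_minus:
  assumes "module K V" and "submodule H K V" and "x \<in> H" and "y \<in> H"
  shows "x \<ominus>\<^bsub>V\<^esub> y \<in> H"
  using assms module.submoduleE(3,5)[of K V H] by (simp add: a_minus_def)

lemma submodule_zero:
  assumes "submodule H K V"
  shows "\<zero>\<^bsub>V\<^esub> \<in> H"
  using subgroup.one_closed[OF submodule.axioms(1)[OF assms]] by simp

text \<open>Spans are formed in the additive group.  This loses nothing, since the generating sets below
  are stable under scalars, so that their spans are submodules.\<close>

lemma linear_image_generate: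
  assumes V: "module K V" and W: "module K W" and f: "f \<in> linear_maps K V W"
    and N: "submodule N K W" and A: "A \<subseteq> carrier V" and fA: "\<And>x. x \<in> A \<Longrightarrow> f x \<in> N"
    and x: "x \<in> generate (add_monoid V) A"
  shows "f x \<in> N"
proof -
  interpret V: module K V by fact
  interpret W: module K W by fact
  have car: "generate (add_monoid V) A \<subseteq> carrier V"
    using V.add.generate_incl[OF A] by simp
  show ?thesis
    using x
  proof induction
    case one
    then show ?case using linear_maps_zero[OF V W f] submodule_zero[OF N] by simp
  next
    case (incl h)
    then show ?case by (rule fA)
  next
    case (inv h)
    then have "f (\<ominus>\<^bsub>V\<^esub> h) \<in> N"
      using A fA linear_maps_uminus[OF V W f, of h] W.submoduleE(3)[OF N] by auto
    then show ?case by (simp add: a_inv_def)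
  next
    case (eng h1 h2)
    then have "h1 \<in> carrier V" "h2 \<in> carrier V"
      using car by blast+
    then show ?case
      using eng linear_maps_add[OF f, of h1 h2] W.submoduleE(5)[OF N] by simp
  qed
qed

lemma submodule_generate:
  assumes V: "module K V" and A: "A \<subseteq> carrier V"
    and smult: "\<And>c x. \<lbrakk>c \<in> carrier K; x \<in> A\<rbrakk> \<Longrightarrow> c \<odot>\<^bsub>V\<^esub> x \<in> A"
  shows "submodule (generate (add_monoid V) A) K V"
proof -
  interpret V: module K V by fact
  let ?N = "generate (add_monoid V) A"
  have sub: "subgroup ?N (add_monoid V)"
    using V.add.generate_is_subgroup[of A] A by simp
  have car: "?N \<subseteq> carrier V"
    using V.add.generate_incl[OF A] by simp
  have "c \<odot>\<^bsub>V\<^esub> x \<in> ?N" if c: "c \<in> carrier K" and x: "x \<in> ?N" for c x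
    using x
  proof induction
    case one
    then show ?case using c generate.one[of "add_monoid V" A] by simp
  next
    case (incl h)
    then show ?case using c smult generate.incl[of "c \<odot>\<^bsub>V\<^esub> h" A] by blast
  next
    case (inv h)
    then have "c \<odot>\<^bsub>V\<^esub> (\<ominus>\<^bsub>V\<^esub> h) = \<ominus>\<^bsub>V\<^esub> (c \<odot>\<^bsub>V\<^esub> h)"
      using A c by (intro V.smult_r_minus) auto
    then show ?case
      using inv generate.inv[OF smult[OF c inv], of "add_monoid V"] by (simp add: a_inv_def)
  next
    case (eng h1 h2)
    then have "c \<odot>\<^bsub>V\<^esub> (h1 \<oplus>\<^bsub>V\<^esub> h2) = c \<odot>\<^bsub>V\<^esub> h1 \<oplus>\<^bsub>V\<^esub> c \<odot>\<^bsub>V\<^esub> h2"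
      using car c by (intro V.smult_r_distr) auto
    then show ?case
      using generate.eng[OF eng(3,4)] by simp
  qed
  then show ?thesis
    using sub by (simp add: submodule_def submodule_axioms_def)
qed

lemma abelian_subgroup_of_submodule:
  assumes "module K V" and "submodule H K V"
  shows "abelian_subgroup H V"
  using assms
  by (intro abelian_subgroupI3 additive_subgroupI) (auto simp: submodule_def module_def)

lemma coset_eq_iff:
  assumes V: "module K V" and H: "submodule H K V" and x: "x \<in> carrier V" and y: "y \<in> carrier V"
  shows "H +>\<^bsub>V\<^esub> x = H +>\<^bsub>V\<^esub> y \<longleftrightarrow> x \<ominus>\<^bsub>V\<^esub> y \<in> H"
proof -
  interpret abelian_subgroup H V by (rule abelian_subgroup_of_submodule[OF V H])
  have "H +>\<^bsub>V\<^esub> x = H +>\<^bsub>V\<^esub> y \<longleftrightarrow> x \<in> H +>\<^bsub>V\<^esub> y"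
    using a_repr_independence'[of x y] a_repr_independenceD[of x y] x y by metis
  then show ?thesis
    using a_rcos_module[OF y x] by (simp add: a_minus_def)
qed

lemma coset_zero:
  assumes V: "module K V" and H: "submodule H K V"
  shows "H +>\<^bsub>V\<^esub> \<zero>\<^bsub>V\<^esub> = H"
proof -
  interpret abelian_subgroup H V by (rule abelian_subgroup_of_submodule[OF V H])
  show ?thesis by (simp add: a_subset)
qed

text \<open>An operation that is constant on a coset can be evaluated at any representative, although it
  is written as a union over the coset.\<close>

lemma coset_UN:
  assumes V: "module K V" and H: "submodule H K V" and x: "x \<in> carrier V"
    and F: "\<And>x'. \<lbrakk>x' \<in> carrier V; x' \<ominus>\<^bsub>V\<^esub> x \<in> H\<rbrakk> \<Longrightarrow> F x' = F x"
  shows "(\<Union>x'\<in>H +>\<^bsub>V\<^esub> x. F x') = F x"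
proof -
  interpret abelian_subgroup H V by (rule abelian_subgroup_of_submodule[OF V H])
  have "F x' = F x" if "x' \<in> H +>\<^bsub>V\<^esub> x" for x'
    using that a_elemrcos_carrier[OF x] a_rcos_module_imp[OF x] by (intro F) (auto simp: a_minus_def)
  moreover have "x \<in> H +>\<^bsub>V\<^esub> x"
    using x by (rule a_rcos_self)
  ultimately show ?thesis by blast
qed

lemma carrier_quot_module: "carrier (quot_module V H) = (\<lambda>x. H +>\<^bsub>V\<^esub> x) ` carrier V"
  by (auto simp: quot_module_def A_RCOSETS_def')

lemma quot_module_zero: "\<zero>\<^bsub>quot_module V H\<^esub> = H"
  by (simp add: quot_module_def)

lemma quot_module_add:
  assumes V: "module K V" and H: "submodule H K V" and x: "x \<in> carrier V" and y: "y \<in> carrier V"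
  shows "(H +>\<^bsub>V\<^esub> x) \<oplus>\<^bsub>quot_module V H\<^esub> (H +>\<^bsub>V\<^esub> y) = H +>\<^bsub>V\<^esub> (x \<oplus>\<^bsub>V\<^esub> y)"
proof -
  interpret abelian_subgroup H V by (rule abelian_subgroup_of_submodule[OF V H])
  show ?thesis
    using a_rcos_sum[OF x y] by (simp add: quot_module_def)
qed

lemma quot_module_smult:
  assumes V: "module K V" and H: "submodule H K V" and c: "c \<in> carrier K" and x: "x \<in> carrier V"
  shows "c \<odot>\<^bsub>quot_module V H\<^esub> (H +>\<^bsub>V\<^esub> x) = H +>\<^bsub>V\<^esub> (c \<odot>\<^bsub>V\<^esub> x)"
proof -
  interpret V: module K V by fact
  have "H +>\<^bsub>V\<^esub> (c \<odot>\<^bsub>V\<^esub> x') = H +>\<^bsub>V\<^esub> (c \<odot>\<^bsub>V\<^esub> x)"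
    if "x' \<in> carrier V" "x' \<ominus>\<^bsub>V\<^esub> x \<in> H" for x'
  proof -
    have "c \<odot>\<^bsub>V\<^esub> x' \<ominus>\<^bsub>V\<^esub> c \<odot>\<^bsub>V\<^esub> x = c \<odot>\<^bsub>V\<^esub> (x' \<ominus>\<^bsub>V\<^esub> x)"
      using that c x by (simp add: a_minus_def V.smult_r_distr V.smult_r_minus)
    then show ?thesis
      using that c x V.submoduleE(4)[OF H] by (subst coset_eq_iff[OF V H]) auto
  qed
  then show ?thesis
    using coset_UN[OF V H x, of "\<lambda>x. H +>\<^bsub>V\<^esub> (c \<odot>\<^bsub>V\<^esub> x)"] by (simp add: quot_module_def)
qed

lemma quot_module_module:
  assumes V: "module K V" and H: "submodule H K V"
  shows "module K (quot_module V H)"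
proof -
  interpret V: module K V by fact
  note [simp] = quot_module_add[OF V H] quot_module_smult[OF V H]
  have z: "\<zero>\<^bsub>quot_module V H\<^esub> = H +>\<^bsub>V\<^esub> \<zero>\<^bsub>V\<^esub>"
    by (simp add: quot_module_zero coset_zero[OF V H])
  have inv: "\<exists>y \<in> carrier V. (H +>\<^bsub>V\<^esub> y) \<oplus>\<^bsub>quot_module V H\<^esub> (H +>\<^bsub>V\<^esub> x) = H +>\<^bsub>V\<^esub> \<zero>\<^bsub>V\<^esub>"
    if "x \<in> carrier V" for x
    using that by (intro bexI[of _ "\<ominus>\<^bsub>V\<^esub> x"]) (auto simp: V.M.l_neg)
  show ?thesis
    by (intro moduleI abelian_groupI)
      (use inv in \<open>auto simp: carrier_quot_module z V.is_cring V.M.a_assoc V.M.a_comm V.M.a_lcomm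
        V.smult_l_distr V.smult_r_distr V.smult_assoc1\<close>)
qed

lemma linear_maps_quot_module:
  assumes V: "module K V" and H: "submodule H K V"
    and W: "module K W" and H': "submodule H' K W"
    and f: "f \<in> linear_maps K V W"
    and F: "\<And>x. x \<in> carrier V \<Longrightarrow> F (H +>\<^bsub>V\<^esub> x) = H' +>\<^bsub>W\<^esub> f x"
  shows "F \<in> linear_maps K (quot_module V H) (quot_module W H')"
proof -
  interpret V: module K V by fact
  note f' = linear_maps_closed[OF f] linear_maps_add[OF f] linear_maps_smult[OF f]
  show ?thesis
    by (rule linear_mapsI)
      (auto simp: carrier_quot_module F f' quot_module_add[OF V H] quot_module_smult[OF V H]
        quot_module_add[OF W H'] quot_module_smult[OF W H'])
qed

section \<open>Cohomology\<close>

context dg_smodule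
begin

lemma diff_diff': "x \<in> elts M n (d - 1) \<Longrightarrow> diff M n d (diff M n (d - 1) x) = \<zero>\<^bsub>piece M n (d + 1)\<^esub>"
  using diff_diff[of x n "d - 1"] by (simp add: add.commute)

lemma diff_linear': "diff M n (d - 1) \<in> linear_maps K (piece M n (d - 1)) (piece M n d)"
  using diff_linear[of n "d - 1"] by simp

lemma submodule_cocycles: "submodule (cocycles M n d) K (piece M n d)"
proof -
  interpret V: module K "piece M n d" by (rule piece_module)
  interpret W: module K "piece M n (d + 1)" by (rule piece_module)
  note D = diff_linear[of n d]
  show ?thesis
    by (rule V.submoduleI)
      (auto simp: cocycles_def linear_maps_add[OF D] linear_maps_smult[OF D]
        linear_maps_uminus[OF piece_module piece_module D] linear_maps_zero[OF piece_module piece_module D])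
qed

lemma submodule_coboundaries: "submodule (coboundaries M n d) K (piece M n d)"
proof -
  interpret V: module K "piece M n (d - 1)" by (rule piece_module)
  interpret W: module K "piece M n d" by (rule piece_module)
  note D = diff_linear'[of n d]
  show ?thesis
  proof (rule W.submoduleI)
    show "coboundaries M n d \<subseteq> elts M n d"
      by (auto simp: coboundaries_def linear_maps_closed[OF D])
    show "\<zero>\<^bsub>piece M n d\<^esub> \<in> coboundaries M n d"
      using linear_maps_zero[OF piece_module piece_module D] V.M.zero_closed
      unfolding coboundaries_def by (metis image_eqI)
    show "\<ominus>\<^bsub>piece M n d\<^esub> x \<in> coboundaries M n d" if "x \<in> coboundaries M n d" for x
      using that linear_maps_uminus[OF piece_module piece_module D] V.M.a_inv_closed
      unfolding coboundaries_def by (smt (verit) image_iff)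
    show "x \<oplus>\<^bsub>piece M n d\<^esub> y \<in> coboundaries M n d"
      if "x \<in> coboundaries M n d" "y \<in> coboundaries M n d" for x y
      using that linear_maps_add[OF D] V.M.add.m_closed
      unfolding coboundaries_def by (smt (verit) image_iff)
    show "c \<odot>\<^bsub>piece M n d\<^esub> x \<in> coboundaries M n d"
      if "c \<in> carrier K" "x \<in> coboundaries M n d" for c x
      using that linear_maps_smult[OF D] V.smult_closed
      unfolding coboundaries_def by (smt (verit) image_iff)
  qed
qed

lemma coboundaries_subset_cocycles: "coboundaries M n d \<subseteq> cocycles M n d"
  using linear_maps_closed[OF diff_linear'[of n d]] diff_diff'
  by (auto simp: coboundaries_def cocycles_def)

lemma module_cocycles: "module K ((piece M n d)\<lparr>carrier := cocycles M n d\<rparr>)"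
  by (rule submodule.submodule_is_module[OF submodule_cocycles piece_module])

lemma submodule_coboundaries_cocycles:
  "submodule (coboundaries M n d) K ((piece M n d)\<lparr>carrier := cocycles M n d\<rparr>)"
proof -
  interpret Z: module K "(piece M n d)\<lparr>carrier := cocycles M n d\<rparr>" by (rule module_cocycles)
  note B = submodule_coboundaries[of n d]
  show ?thesis
  proof (rule Z.module_incl_imp_submodule)
    show "module K (piece M n d\<lparr>carrier := cocycles M n d, carrier := coboundaries M n d\<rparr>)"
      using submodule.submodule_is_module[OF B piece_module] by simp
  qed (use coboundaries_subset_cocycles in auto)
qed

end

lemma r_coset_carrier_update: "X +>\<^bsub>V\<lparr>carrier := Z\<rparr>\<^esub> x = X +>\<^bsub>V\<^esub> x"
  by (simp add: a_r_coset_def')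

text \<open>Injectivity and surjectivity on cohomology, expressed by representatives.  The second condition
  allows the class of \<open>y\<close> to be hit without exhibiting a map backwards.\<close>

lemma quasi_iso_criterion:
  fixes f :: "nat \<Rightarrow> int \<Rightarrow> 'a \<Rightarrow> 'b"
  assumes A: "dg_smodule K A" and B: "dg_smodule K B"
    and f: "\<And>n d. f n d \<in> linear_maps K (piece A n d) (piece B n d)"
    and chain: "\<And>n d x. x \<in> elts A n d \<Longrightarrow> f n (d + 1) (diff A n d x) = diff B n d (f n d x)"
    and inj: "\<And>n d x. \<lbrakk>x \<in> cocycles A n d; f n d x \<in> coboundaries B n d\<rbrakk> \<Longrightarrow> x \<in> coboundaries A n d"
    and surj: "\<And>n d y. y \<in> cocycles B n d \<Longrightarrow>
      \<exists>x \<in> cocycles A n d. y \<ominus>\<^bsub>piece B n d\<^esub> f n d x \<in> coboundaries B n d"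
  shows "cohomology_map B f n d \<in> linear_maps K (cohomology A n d) (cohomology B n d)"
    and "bij_betw (cohomology_map B f n d) (carrier (cohomology A n d)) (carrier (cohomology B n d))"
proof -
  interpret A: dg_smodule K A by fact
  interpret B: dg_smodule K B by fact
  let ?ZA = "(piece A n d)\<lparr>carrier := cocycles A n d\<rparr>"
  let ?ZB = "(piece B n d)\<lparr>carrier := cocycles B n d\<rparr>"
  let ?BA = "coboundaries A n d" and ?BB = "coboundaries B n d"
  let ?F = "cohomology_map B f n d"
  interpret VA: module K "piece A n d" by (rule A.piece_module)
  interpret VB: module K "piece B n d" by (rule B.piece_module)
  have minus_A: "x \<ominus>\<^bsub>?ZA\<^esub> y = x \<ominus>\<^bsub>piece A n d\<^esub> y" if "x \<in> cocycles A n d" "y \<in> cocycles A n d" for x y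
  proof -
    have "f \<in> linear_maps K ?ZA (piece A n d)" if "f = id" for f
      using that A.submodule_cocycles VA.submoduleE(1) by (intro linear_mapsI) fastforce+
    from linear_maps_minus[OF A.module_cocycles A.piece_module this[OF refl]] that show ?thesis
      by simp
  qed
  have cocycle: "f n d x \<in> cocycles B n d" if "x \<in> cocycles A n d" for x
    using that linear_maps_closed[OF f] chain[of x n d]
      linear_maps_zero[OF A.piece_module B.piece_module f[of n "d + 1"]]
    by (auto simp: cocycles_def)
  have cobdry: "f n d x \<in> ?BB" if "x \<in> ?BA" for x
    using that chain[of _ n "d - 1"] linear_maps_closed[OF f[of n "d - 1"]]
    by (auto simp: coboundaries_def)
  have Zcar: "x \<in> elts A n d" if "x \<in> cocycles A n d" for x
    using that by (simp add: cocycles_def)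
  have ZcarB: "x \<in> elts B n d" if "x \<in> cocycles B n d" for x
    using that by (simp add: cocycles_def)
  have F: "?F (?BA +>\<^bsub>?ZA\<^esub> x) = ?BB +>\<^bsub>?ZB\<^esub> f n d x" if x: "x \<in> carrier ?ZA" for x
  proof -
    have "?BB +>\<^bsub>piece B n d\<^esub> f n d x' = ?BB +>\<^bsub>piece B n d\<^esub> f n d x"
      if x': "x' \<in> carrier ?ZA" and xx': "x' \<ominus>\<^bsub>?ZA\<^esub> x \<in> ?BA" for x'
    proof -
      have "f n d x' \<ominus>\<^bsub>piece B n d\<^esub> f n d x = f n d (x' \<ominus>\<^bsub>piece A n d\<^esub> x)"
        using x x' Zcar by (simp add: linear_maps_minus[OF A.piece_module B.piece_module f])
      also have "\<dots> \<in> ?BB"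
        using cobdry xx' minus_A x x' by simp
      finally show ?thesis
        using x x' Zcar linear_maps_closed[OF f]
        by (subst coset_eq_iff[OF B.piece_module B.submodule_coboundaries]) auto
    qed
    then show ?thesis
      unfolding cohomology_map_def r_coset_carrier_update[of _ "piece B n d"]
      by (intro coset_UN[OF A.module_cocycles A.submodule_coboundaries_cocycles x]) auto
  qed
  have flin: "f n d \<in> linear_maps K ?ZA ?ZB"
    using linear_maps_add[OF f] linear_maps_smult[OF f] cocycle Zcar
    by (intro linear_mapsI) auto
  show lin: "?F \<in> linear_maps K (cohomology A n d) (cohomology B n d)"
    unfolding cohomology_def
    by (rule linear_maps_quot_module[OF A.module_cocycles A.submodule_coboundaries_cocycles
          B.module_cocycles B.submodule_coboundaries_cocycles flin F])
  show "bij_betw ?F (carrier (cohomology A n d)) (carrier (cohomology B n d))"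
    unfolding bij_betw_def
  proof
    show "inj_on ?F (carrier (cohomology A n d))"
    proof (rule inj_onI)
      fix X Y assume "X \<in> carrier (cohomology A n d)" "Y \<in> carrier (cohomology A n d)"
      then obtain x y where x: "x \<in> cocycles A n d" "X = ?BA +>\<^bsub>?ZA\<^esub> x"
        and y: "y \<in> cocycles A n d" "Y = ?BA +>\<^bsub>?ZA\<^esub> y"
        by (auto simp: cohomology_def carrier_quot_module)
      assume "?F X = ?F Y"
      then have "?BB +>\<^bsub>piece B n d\<^esub> f n d x = ?BB +>\<^bsub>piece B n d\<^esub> f n d y"
        using x y F by (simp add: r_coset_carrier_update)
      then have "f n d x \<ominus>\<^bsub>piece B n d\<^esub> f n d y \<in> ?BB"
        using x y Zcar linear_maps_closed[OF f]
        by (subst (asm) coset_eq_iff[OF B.piece_module B.submodule_coboundaries]) auto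
      then have "f n d (x \<ominus>\<^bsub>piece A n d\<^esub> y) \<in> ?BB"
        using x y Zcar by (simp add: linear_maps_minus[OF A.piece_module B.piece_module f])
      moreover have "x \<ominus>\<^bsub>piece A n d\<^esub> y \<in> cocycles A n d"
        using x y by (intro submodule_minus[OF A.piece_module A.submodule_cocycles])
      ultimately have "x \<ominus>\<^bsub>piece A n d\<^esub> y \<in> ?BA"
        using inj by blast
      then show "X = Y"
        using x y Zcar unfolding x(2) y(2) r_coset_carrier_update
        by (subst coset_eq_iff[OF A.piece_module A.submodule_coboundaries]) auto
    qed
    show "?F ` carrier (cohomology A n d) = carrier (cohomology B n d)"
    proof
      show "?F ` carrier (cohomology A n d) \<subseteq> carrier (cohomology B n d)"
        using linear_maps_closed[OF lin] by blast
      show "carrier (cohomology B n d) \<subseteq> ?F ` carrier (cohomology A n d)"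
      proof
        fix Y assume "Y \<in> carrier (cohomology B n d)"
        then obtain y where y: "y \<in> cocycles B n d" "Y = ?BB +>\<^bsub>?ZB\<^esub> y"
          by (auto simp: cohomology_def carrier_quot_module)
        obtain x where x: "x \<in> cocycles A n d" "y \<ominus>\<^bsub>piece B n d\<^esub> f n d x \<in> ?BB"
          using surj[OF y(1)] by blast
        have "Y = ?F (?BA +>\<^bsub>?ZA\<^esub> x)"
          using x y Zcar ZcarB linear_maps_closed[OF f] F[of x] unfolding r_coset_carrier_update
          by (subst (asm) coset_eq_iff[OF B.piece_module B.submodule_coboundaries, symmetric]) auto
        then show "Y \<in> ?F ` carrier (cohomology A n d)"
          using x(1) by (auto simp: cohomology_def carrier_quot_module)
      qed
    qed
  qed
qed


section \<open>Permutations of inputs\<close>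

text \<open>\<open>perm_cmp n i \<sigma> \<tau>\<close> moves the block of the \<open>n\<close> inputs of the second factor from position \<open>i\<close> to
  position \<open>\<sigma> i\<close>, permutes it by \<open>\<tau>\<close>, and permutes the other inputs by \<open>\<sigma>\<close>.  It has to be a
  permutation for the right-hand side of the equivariance axiom to be defined.  The case \<open>n = 0\<close>, in
  which the block is empty and the arity drops, is included.\<close>

lemma perm_cmp_permutes:
  assumes i: "1 \<le> i" "i \<le> m" and \<sigma>: "\<sigma> permutes {1..m}" and \<tau>: "\<tau> permutes {1..n}"
  shows "perm_cmp n i \<sigma> \<tau> permutes {1..m + n - 1}"
proof -
  have \<sigma>_in: "\<sigma> k \<in> {1..m} \<longleftrightarrow> k \<in> {1..m}" for k by (rule permutes_in_image[OF \<sigma>])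
  have \<tau>_in: "\<tau> k \<in> {1..n} \<longleftrightarrow> k \<in> {1..n}" for k by (rule permutes_in_image[OF \<tau>])
  have \<sigma>_out: "\<sigma> k = k" if "k \<notin> {1..m}" for k using that by (rule permutes_not_in[OF \<sigma>])
  have \<sigma>_eq: "\<sigma> k = \<sigma> l \<longleftrightarrow> k = l" for k l using permutes_inj[OF \<sigma>] by (auto dest: injD)
  have \<tau>_eq: "\<tau> k = \<tau> l \<longleftrightarrow> k = l" for k l using permutes_inj[OF \<tau>] by (auto dest: injD)
  define shift where "shift s = (if s < \<sigma> i then s else s + n - 1)" for s
  have si: "1 \<le> \<sigma> i" "\<sigma> i \<le> m" using \<sigma>_in[of i] i by auto
  have eq: "perm_cmp n i \<sigma> \<tau> k = (if k < i then shift (\<sigma> k)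
      else if k < i + n then \<sigma> i + \<tau> (k + 1 - i) - 1 else shift (\<sigma> (k + 1 - n)))" for k
    by (simp add: perm_cmp_def shift_def Let_def)
  \<comment> \<open>The three branches take their values in the complement of \<open>{\<sigma> i..<\<sigma> i + n}\<close>, in this
    interval, and in its complement again.\<close>
  have shift_ne: "shift s < \<sigma> i \<or> \<sigma> i + n \<le> shift s" if "s \<noteq> \<sigma> i" for s
    using that si by (auto simp: shift_def)
  have shift_inj: "s = t" if "shift s = shift t" "s \<noteq> \<sigma> i" "t \<noteq> \<sigma> i" for s t
    using that si by (auto simp: shift_def split: if_splits)
  have mid: "\<sigma> i \<le> \<sigma> i + \<tau> (k + 1 - i) - 1 \<and> \<sigma> i + \<tau> (k + 1 - i) - 1 < \<sigma> i + n \<and> 1 \<le> \<tau> (k + 1 - i)"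
    if "i \<le> k" "k < i + n" for k
    using that \<tau>_in[of "k + 1 - i"] by auto
  have inj: "inj_on (perm_cmp n i \<sigma> \<tau>) {1..m + n - 1}"
  proof (rule inj_onI)
    fix k l assume kl: "perm_cmp n i \<sigma> \<tau> k = perm_cmp n i \<sigma> \<tau> l"
    define outer where "outer k = (if k < i then k else k + 1 - n)" for k
    have outer: "perm_cmp n i \<sigma> \<tau> k = shift (\<sigma> (outer k)) \<and> \<sigma> (outer k) \<noteq> \<sigma> i"
      if "k < i \<or> i + n \<le> k" for k
      using that by (auto simp: eq outer_def \<sigma>_eq)
    have inner: "perm_cmp n i \<sigma> \<tau> k = \<sigma> i + \<tau> (k + 1 - i) - 1" if "i \<le> k" "k < i + n" for k
      using that by (simp add: eq)
    consider "k < i \<or> i + n \<le> k" "l < i \<or> i + n \<le> l" | "k < i \<or> i + n \<le> k" "i \<le> l" "l < i + n"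
      | "i \<le> k" "k < i + n" "l < i \<or> i + n \<le> l" | "i \<le> k" "k < i + n" "i \<le> l" "l < i + n"
      by linarith
    then show "k = l"
    proof cases
      case 1
      then have "outer k = outer l"
        using outer[of k] outer[of l] shift_inj kl \<sigma>_eq by metis
      then show ?thesis using 1 by (auto simp: outer_def split: if_splits)
    next
      case 2
      then show ?thesis
        using outer[of k] inner[of l] mid[of l] shift_ne[of "\<sigma> (outer k)"] kl
        by linarith
    next
      case 3
      then show ?thesis
        using outer[of l] inner[of k] mid[of k] shift_ne[of "\<sigma> (outer l)"] kl
        by linarith
    next
      case 4
      then have "\<tau> (k + 1 - i) = \<tau> (l + 1 - i)"
        using inner[of k] inner[of l] mid[of k] mid[of l] kl by linarith
      then show ?thesis using 4 by (simp add: \<tau>_eq)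
    qed
  qed
  have into: "perm_cmp n i \<sigma> \<tau> k \<in> {1..m + n - 1}" if k: "k \<in> {1..m + n - 1}" for k
  proof -
    have "shift s \<in> {1..m + n - 1}" if "s \<in> {1..m}" "s \<noteq> \<sigma> i" for s
      using that si by (auto simp: shift_def)
    moreover have "\<sigma> l \<in> {1..m} \<and> \<sigma> l \<noteq> \<sigma> i" if "l \<in> {1..m}" "l \<noteq> i" for l
      using that \<sigma>_in \<sigma>_eq by blast
    ultimately have "shift (\<sigma> l) \<in> {1..m + n - 1}" if "l \<in> {1..m}" "l \<noteq> i" for l
      using that by blast
    note outer = this
    consider "k < i" | "i \<le> k" "k < i + n" | "i + n \<le> k" by linarith
    then show ?thesis
    proof cases
      case 1
      then show ?thesis using k i outer[of k] by (simp add: eq)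
    next
      case 2
      then show ?thesis using mid[of k] si by (simp add: eq) linarith
    next
      case 3
      then have "k + 1 - n \<in> {1..m}" "k + 1 - n \<noteq> i" using k i by auto
      then show ?thesis using 3 outer[of "k + 1 - n"] by (simp add: eq)
    qed
  qed
  have out: "perm_cmp n i \<sigma> \<tau> k = k" if "k \<notin> {1..m + n - 1}" for k
  proof (cases "k = 0")
    case True
    then show ?thesis using i si \<sigma>_out[of 0] by (simp add: eq shift_def)
  next
    case False
    then have k: "m + n \<le> k" using that by auto
    then have "\<sigma> (k + 1 - n) = k + 1 - n" using i by (intro \<sigma>_out) auto
    then show ?thesis using k i si by (simp add: eq shift_def)
  qed
  have "bij_betw (perm_cmp n i \<sigma> \<tau>) {1..m + n - 1} {1..m + n - 1}"
    using inj into endo_inj_surj[OF _ _ inj] by (simp add: bij_betw_def image_subset_iff)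
  then show ?thesis
    using out by (rule bij_imp_permutes)
qed

section \<open>Quotients of DG operads by DG ideals\<close>

lemma (in field) ksign_closed: "ksign R a \<in> carrier R"
  by (simp add: ksign_def)

lemma (in dg_operad) cmp_closed: "\<lbrakk>1 \<le> i; i \<le> m; x \<in> elts P m a; y \<in> elts P n b\<rbrakk> \<Longrightarrow>
    cmp P m a n b i x y \<in> elts P (m + n - 1) (a + b)"
  using linear_maps_closed[OF cmp_linear_right] by blast

locale dg_ideal = dg_operad K P
  for K :: "('k, 'r) ring_scheme" (structure) and P :: "('k, 'a, 'm) operad_scheme" +
  fixes I :: "nat \<Rightarrow> int \<Rightarrow> 'a set"
  assumes ideal: "dg_operadic_ideal K P I"
begin

abbreviation Q where "Q \<equiv> quot_operad P I"
abbreviation proj where "proj \<equiv> quot_proj P I"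

lemma ideal_submodule: "submodule (I n d) K (piece P n d)"
  using ideal by (simp add: dg_operadic_ideal_def)

lemma ideal_carrier: "x \<in> I n d \<Longrightarrow> x \<in> elts P n d"
  using module.submoduleE(1)[OF piece_module ideal_submodule] by blast

lemma ideal_act: "\<lbrakk>\<sigma> permutes {1..n}; x \<in> I n d\<rbrakk> \<Longrightarrow> act P n d \<sigma> x \<in> I n d"
  and ideal_cmp_left: "\<lbrakk>1 \<le> i; i \<le> m; x \<in> I m a; y \<in> elts P n b\<rbrakk> \<Longrightarrow>
    cmp P m a n b i x y \<in> I (m + n - 1) (a + b)"
  and ideal_cmp_right: "\<lbrakk>1 \<le> i; i \<le> m; x \<in> elts P m a; y \<in> I n b\<rbrakk> \<Longrightarrow>
    cmp P m a n b i x y \<in> I (m + n - 1) (a + b)"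
  and ideal_diff: "x \<in> I n d \<Longrightarrow> diff P n d x \<in> I n (d + 1)"
  using ideal by (simp_all add: dg_operadic_ideal_def)

lemma proj_eq_iff: "\<lbrakk>x \<in> elts P n d; y \<in> elts P n d\<rbrakk> \<Longrightarrow>
    proj n d x = proj n d y \<longleftrightarrow> x \<ominus>\<^bsub>piece P n d\<^esub> y \<in> I n d"
  unfolding quot_proj_def by (rule coset_eq_iff[OF piece_module ideal_submodule])

lemma elts_Q: "elts Q n d = proj n d ` elts P n d"
  by (simp add: quot_operad_def carrier_quot_module quot_proj_def)

lemma proj_eq_zero_iff: "x \<in> elts P n d \<Longrightarrow> proj n d x = \<zero>\<^bsub>piece Q n d\<^esub> \<longleftrightarrow> x \<in> I n d"
  and zero_Q: "\<zero>\<^bsub>piece Q n d\<^esub> = proj n d \<zero>\<^bsub>piece P n d\<^esub>"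
proof -
  interpret V: module K "piece P n d" by (rule piece_module)
  show z: "\<zero>\<^bsub>piece Q n d\<^esub> = proj n d \<zero>\<^bsub>piece P n d\<^esub>"
    using coset_zero[OF piece_module ideal_submodule]
    by (simp add: quot_operad_def quot_module_zero quot_proj_def)
  show "x \<in> elts P n d \<Longrightarrow> proj n d x = \<zero>\<^bsub>piece Q n d\<^esub> \<longleftrightarrow> x \<in> I n d"
    by (simp add: z proj_eq_iff module_minus_zero[OF piece_module])
qed

lemma piece_module_Q: "module K (piece Q n d)"
  using quot_module_module[OF piece_module ideal_submodule] by (simp add: quot_operad_def)

lemma add_Q: "\<lbrakk>x \<in> elts P n d; y \<in> elts P n d\<rbrakk> \<Longrightarrow>
    proj n d x \<oplus>\<^bsub>piece Q n d\<^esub> proj n d y = proj n d (x \<oplus>\<^bsub>piece P n d\<^esub> y)"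
  and smult_Q: "\<lbrakk>c \<in> carrier K; x \<in> elts P n d\<rbrakk> \<Longrightarrow>
    c \<odot>\<^bsub>piece Q n d\<^esub> proj n d x = proj n d (c \<odot>\<^bsub>piece P n d\<^esub> x)"
  using quot_module_add[OF piece_module ideal_submodule] quot_module_smult[OF piece_module ideal_submodule]
  by (simp_all add: quot_operad_def quot_proj_def)

lemma proj_UN:
  assumes "x \<in> elts P n d" 
    and "\<And>x'. \<lbrakk>x' \<in> elts P n d; x' \<ominus>\<^bsub>piece P n d\<^esub> x \<in> I n d\<rbrakk> \<Longrightarrow> F x' = F x"
  shows "(\<Union>x'\<in>proj n d x. F x') = F x"
  unfolding quot_proj_def by (rule coset_UN[OF piece_module ideal_submodule assms(1)]) (rule assms(2))

text \<open>A linear map that preserves the ideal is well defined on cosets; the action, the differential and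
  the partial compositions in each variable are all instances.\<close>

lemma proj_linear_eq:
  assumes f: "f \<in> linear_maps K (piece P n d) (piece P n' d')"
    and fI: "\<And>x. x \<in> I n d \<Longrightarrow> f x \<in> I n' d'"
    and "x \<in> elts P n d" "x' \<in> elts P n d" "x' \<ominus>\<^bsub>piece P n d\<^esub> x \<in> I n d"
  shows "proj n' d' (f x') = proj n' d' (f x)"
  using fI[OF assms(5)] assms(3,4) linear_maps_closed[OF f]
  by (simp add: proj_eq_iff linear_maps_minus[OF piece_module piece_module f])

lemma act_Q:
  assumes "\<sigma> permutes {1..n}" "x \<in> elts P n d"
  shows "act Q n d \<sigma> (proj n d x) = proj n d (act P n d \<sigma> x)"
proof -
  have "(\<Union>x'\<in>proj n d x. proj n d (act P n d \<sigma> x')) = proj n d (act P n d \<sigma> x)"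
    by (rule proj_UN[OF assms(2)], rule proj_linear_eq[OF act_linear ideal_act]) (use assms in auto)
  then show ?thesis by (simp add: quot_operad_def)
qed

lemma diff_Q:
  assumes "x \<in> elts P n d"
  shows "diff Q n d (proj n d x) = proj n (d + 1) (diff P n d x)"
proof -
  have "(\<Union>x'\<in>proj n d x. proj n (d + 1) (diff P n d x')) = proj n (d + 1) (diff P n d x)"
    by (rule proj_UN[OF assms], rule proj_linear_eq[OF diff_linear ideal_diff]) (use assms in auto)
  then show ?thesis by (simp add: quot_operad_def)
qed

lemma cmp_Q:
  assumes i: "1 \<le> i" "i \<le> m" and x: "x \<in> elts P m a" and y: "y \<in> elts P n b"
  shows "cmp Q m a n b i (proj m a x) (proj n b y) = proj (m + n - 1) (a + b) (cmp P m a n b i x y)"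
proof -
  have r: "proj (m + n - 1) (a + b) (cmp P m a n b i x' y') = proj (m + n - 1) (a + b) (cmp P m a n b i x' y)"
    if "x' \<in> elts P m a" "y' \<in> elts P n b" "y' \<ominus>\<^bsub>piece P n b\<^esub> y \<in> I n b" for x' y'
    using that y i by (intro proj_linear_eq[OF cmp_linear_right ideal_cmp_right]) 
  have l: "proj (m + n - 1) (a + b) (cmp P m a n b i x' y) = proj (m + n - 1) (a + b) (cmp P m a n b i x y)"
    if "x' \<in> elts P m a" "x' \<ominus>\<^bsub>piece P m a\<^esub> x \<in> I m a" for x'
    using that x y i by (intro proj_linear_eq[OF cmp_linear_left ideal_cmp_left]) 
  let ?F = "\<lambda>x' y'. proj (m + n - 1) (a + b) (cmp P m a n b i x' y')"
  have in1: "(\<Union>y'\<in>proj n b y. ?F x' y') = ?F x' y" if "x' \<in> elts P m a" for x'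
    using that by (intro proj_UN[OF y] r)
  have "(\<Union>x'\<in>proj m a x. \<Union>y'\<in>proj n b y. ?F x' y') = (\<Union>y'\<in>proj n b y. ?F x y')"
    by (rule proj_UN[OF x]) (simp only: in1 x l)
  then show ?thesis
    unfolding in1[OF x] by (simp add: quot_operad_def)
qed

lemma unit_Q: "unit Q = proj 1 0 (unit P)"
  by (simp add: quot_operad_def)

lemma proj_linear: "proj n d \<in> linear_maps K (piece P n d) (piece Q n d)"
  by (rule linear_mapsI) (auto simp: elts_Q add_Q smult_Q)

lemma linear_maps_Q:
  assumes f: "f \<in> linear_maps K (piece P n d) (piece P n' d')"
    and F: "\<And>x. x \<in> elts P n d \<Longrightarrow> F (proj n d x) = proj n' d' (f x)"
  shows "F \<in> linear_maps K (piece Q n d) (piece Q n' d')"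
  using linear_maps_quot_module[OF piece_module ideal_submodule piece_module ideal_submodule f] F
  by (simp add: quot_operad_def quot_proj_def)

text \<open>The axioms are inherited from \<open>P\<close>: each is an equation between operations, and the projection
  is surjective and commutes with all operations.\<close>

lemma quot_dg_operad: "dg_operad K Q"
proof -
  have smod: "dg_smodule K Q"
  proof (intro dg_smodule.intro dg_smodule_axioms.intro)
    show "field K" by (rule field_axioms)
  next
    fix n :: nat and d and \<sigma> \<tau> :: "nat \<Rightarrow> nat" and X
    assume \<sigma>: "\<sigma> permutes {1..n}"
    show "act Q n d \<sigma> \<in> linear_maps K (piece Q n d) (piece Q n d)"
      by (rule linear_maps_Q[OF act_linear[OF \<sigma>]]) (rule act_Q[OF \<sigma>])
    assume X: "X \<in> elts Q n d"
    show "diff Q n d (act Q n d \<sigma> X) = act Q n (d + 1) \<sigma> (diff Q n d X)"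
      using X \<sigma> linear_maps_closed[OF act_linear] linear_maps_closed[OF diff_linear]
      by (auto simp: elts_Q act_Q diff_Q diff_act)
    assume \<tau>: "\<tau> permutes {1..n}"
    show "act Q n d \<tau> (act Q n d \<sigma> X) = act Q n d (\<sigma> \<circ> \<tau>) X"
      using X \<sigma> \<tau> linear_maps_closed[OF act_linear] permutes_compose[OF \<tau> \<sigma>]
      by (auto simp: elts_Q act_Q act_act)
  next
    fix n :: nat and d :: int and X
    show "module K (piece Q n d)" by (rule piece_module_Q)
    show "diff Q n d \<in> linear_maps K (piece Q n d) (piece Q n (d + 1))"
      by (rule linear_maps_Q[OF diff_linear diff_Q])
    assume X: "X \<in> elts Q n d"
    show "act Q n d id X = X"
      using X permutes_id by (auto simp: elts_Q act_Q act_id)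
    show "diff Q n (d + 1) (diff Q n d X) = \<zero>\<^bsub>piece Q n (d + 2)\<^esub>"
      using X linear_maps_closed[OF diff_linear]
      by (auto simp: elts_Q diff_Q diff_diff zero_Q add.assoc)
  qed
  show ?thesis
  proof (intro dg_operad.intro[OF smod] dg_operad_axioms.intro)
    show "unit Q \<in> elts Q 1 0"
      using unit_closed by (simp add: unit_Q elts_Q)
  next
    fix i m n :: nat and b a :: int and Y
    assume i: "1 \<le> i" "i \<le> m" and "Y \<in> elts Q n b"
    then obtain y where y: "y \<in> elts P n b" "Y = proj n b y" by (auto simp: elts_Q)
    show "(\<lambda>X. cmp Q m a n b i X Y) \<in> linear_maps K (piece Q m a) (piece Q (m + n - 1) (a + b))"
      unfolding y(2) by (rule linear_maps_Q[OF cmp_linear_left[OF i y(1)]]) (rule cmp_Q[OF i _ y(1)])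
  next
    fix i m n :: nat and a b :: int and X
    assume i: "1 \<le> i" "i \<le> m" and "X \<in> elts Q m a"
    then obtain x where x: "x \<in> elts P m a" "X = proj m a x" by (auto simp: elts_Q)
    show "cmp Q m a n b i X \<in> linear_maps K (piece Q n b) (piece Q (m + n - 1) (a + b))"
      unfolding x(2) by (rule linear_maps_Q[OF cmp_linear_right[OF i x(1)]]) (rule cmp_Q[OF i x(1)])
  next
    fix n :: nat and b :: int and Y
    assume "Y \<in> elts Q n b"
    then obtain y where y: "y \<in> elts P n b" "Y = proj n b y" by (auto simp: elts_Q)
    show "cmp Q 1 0 n b 1 (unit Q) Y = Y"
      using cmp_Q[of 1 1 "unit P" 0 y n b] unit_closed unit_left[OF y(1)] y by (simp add: unit_Q)
  next
    fix i m :: nat and a :: int and X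
    assume i: "1 \<le> i" "i \<le> m" and "X \<in> elts Q m a"
    then obtain x where x: "x \<in> elts P m a" "X = proj m a x" by (auto simp: elts_Q)
    show "cmp Q m a 1 0 i X (unit Q) = X"
      using cmp_Q[OF i x(1) unit_closed] unit_right[OF i x(1)] x(2) by (simp add: unit_Q)
  next
    fix i m j n q :: nat and a b c :: int and X Y Z
    assume i: "1 \<le> i" "i \<le> m" and j: "1 \<le> j" "j \<le> n"
      and "X \<in> elts Q m a" "Y \<in> elts Q n b" "Z \<in> elts Q q c"
    then obtain x y z where x: "x \<in> elts P m a" "X = proj m a x"
      and y: "y \<in> elts P n b" "Y = proj n b y" and z: "z \<in> elts P q c" "Z = proj q c z"
      by (auto simp: elts_Q)
    have ij: "1 \<le> i + j - 1" "i + j - 1 \<le> m + n - 1" using i j by auto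
    have e: "m + n - 1 + q - 1 = m + (n + q - 1) - 1" using i j by auto
    show "cmp Q (m + n - 1) (a + b) q c (i + j - 1) (cmp Q m a n b i X Y) Z =
      cmp Q m a (n + q - 1) (b + c) i X (cmp Q n b q c j Y Z)"
      unfolding x(2) y(2) z(2) cmp_Q[OF i x(1) y(1)] cmp_Q[OF j y(1) z(1)]
        cmp_Q[OF ij cmp_closed[OF i x(1) y(1)] z(1)] cmp_Q[OF i x(1) cmp_closed[OF j y(1) z(1)]]
        cmp_sequential[OF i j x(1) y(1) z(1)] e add.assoc ..
  next
    fix i k m n q :: nat and a b c :: int and X Y Z
    assume ik: "1 \<le> i" "i < k" "k \<le> m"
      and "X \<in> elts Q m a" "Y \<in> elts Q n b" "Z \<in> elts Q q c"
    then obtain x y z where x: "x \<in> elts P m a" "X = proj m a x"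
      and y: "y \<in> elts P n b" "Y = proj n b y" and z: "z \<in> elts P q c" "Z = proj q c z"
      by (auto simp: elts_Q)
    have i: "1 \<le> i" "i \<le> m" and k: "1 \<le> k" "k \<le> m"
      and kn: "1 \<le> k + n - 1" "k + n - 1 \<le> m + n - 1" and i': "i \<le> m + q - 1" using ik by auto
    have e: "m + n - 1 + q - 1 = m + n + q - 2" "m + q - 1 + n - 1 = m + n + q - 2"
      "a + c + b = a + b + c" using ik by auto
    have w: "cmp P (m + q - 1) (a + c) n b i (cmp P m a q c k x z) y \<in> elts P (m + n + q - 2) (a + b + c)"
      using cmp_closed[OF i(1) i' cmp_closed[OF k x(1) z(1)] y(1)] unfolding e .
    show "cmp Q (m + n - 1) (a + b) q c (k + n - 1) (cmp Q m a n b i X Y) Z =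
       ksign K (b * c) \<odot>\<^bsub>piece Q (m + n + q - 2) (a + b + c)\<^esub>
       cmp Q (m + q - 1) (a + c) n b i (cmp Q m a q c k X Z) Y"
      unfolding x(2) y(2) z(2) cmp_Q[OF i x(1) y(1)] cmp_Q[OF k x(1) z(1)]
        cmp_Q[OF kn cmp_closed[OF i x(1) y(1)] z(1)]
        cmp_Q[OF i(1) i' cmp_closed[OF k x(1) z(1)] y(1)]
        cmp_parallel[OF ik x(1) y(1) z(1)] e smult_Q[OF ksign_closed w] ..
  next
    fix i m n :: nat and a b :: int and \<sigma> \<tau> :: "nat \<Rightarrow> nat" and X Y
    assume i: "1 \<le> i" "i \<le> m" and \<sigma>: "\<sigma> permutes {1..m}" and \<tau>: "\<tau> permutes {1..n}"
      and "X \<in> elts Q m a" "Y \<in> elts Q n b"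
    then obtain x y where x: "x \<in> elts P m a" "X = proj m a x"
      and y: "y \<in> elts P n b" "Y = proj n b y"
      by (auto simp: elts_Q)
    have si: "1 \<le> \<sigma> i" "\<sigma> i \<le> m" using permutes_in_image[OF \<sigma>, of i] i by auto
    have pc: "perm_cmp n i \<sigma> \<tau> permutes {1..m + n - 1}"
      by (rule perm_cmp_permutes[OF i \<sigma> \<tau>])
    show "cmp Q m a n b i (act Q m a \<sigma> X) (act Q n b \<tau> Y) =
       act Q (m + n - 1) (a + b) (perm_cmp n i \<sigma> \<tau>) (cmp Q m a n b (\<sigma> i) X Y)"
      unfolding x(2) y(2) act_Q[OF \<sigma> x(1)] act_Q[OF \<tau> y(1)] cmp_Q[OF si x(1) y(1)]
        cmp_Q[OF i linear_maps_closed[OF act_linear[OF \<sigma>] x(1)] linear_maps_closed[OF act_linear[OF \<tau>] y(1)]]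
        act_Q[OF pc cmp_closed[OF si x(1) y(1)]] cmp_act[OF i \<sigma> \<tau> x(1) y(1)] ..
  next
    fix i m n :: nat and a b :: int and X Y
    assume i: "1 \<le> i" "i \<le> m" and "X \<in> elts Q m a" "Y \<in> elts Q n b"
    then obtain x y where x: "x \<in> elts P m a" "X = proj m a x"
      and y: "y \<in> elts P n b" "Y = proj n b y"
      by (auto simp: elts_Q)
    have e: "a + 1 + b = a + b + 1" "a + (b + 1) = a + b + 1" by auto
    note dx = linear_maps_closed[OF diff_linear x(1)] and dy = linear_maps_closed[OF diff_linear y(1)]
    note c1 = cmp_closed[OF i dx y(1), unfolded e] and c2 = cmp_closed[OF i x(1) dy, unfolded e]
    show "diff Q (m + n - 1) (a + b) (cmp Q m a n b i X Y) =
       cmp Q m (a + 1) n b i (diff Q m a X) Y \<oplus>\<^bsub>piece Q (m + n - 1) (a + b + 1)\<^esub>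
       ksign K a \<odot>\<^bsub>piece Q (m + n - 1) (a + b + 1)\<^esub> cmp Q m a n (b + 1) i X (diff Q n b Y)"
      unfolding x(2) y(2) cmp_Q[OF i x(1) y(1)] diff_Q[OF cmp_closed[OF i x(1) y(1)]]
        diff_Q[OF x(1)] diff_Q[OF y(1)] cmp_Q[OF i dx y(1)] cmp_Q[OF i x(1) dy] e
        smult_Q[OF ksign_closed c2]
        add_Q[OF c1 module.smult_closed[OF piece_module ksign_closed c2]]
        diff_cmp[OF i x(1) y(1)] ..
  qed
qed

lemma proj_hom: "dg_operad_hom K P Q proj"
  using proj_linear by (auto simp: dg_operad_hom_def graded_maps_def equivariant_def act_Q diff_Q cmp_Q unit_Q)

end

lemma dg_operad_hom_comp:
  assumes f: "dg_operad_hom K A B f" and g: "dg_operad_hom K B D g"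
  shows "dg_operad_hom K A D (\<lambda>n d x. g n d (f n d x))"
proof -
  have lin: "f n d \<in> linear_maps K (piece A n d) (piece B n d)"
      "g n d \<in> linear_maps K (piece B n d) (piece D n d)" for n d
    using f g by (auto simp: dg_operad_hom_def graded_maps_def)
  then show ?thesis
    using f g linear_maps_comp[OF lin] linear_maps_closed[OF lin(1)]
    by (auto simp: dg_operad_hom_def graded_maps_def equivariant_def)
qed

text \<open>The intersection that defines the generated ideal ranges over a nonempty family, since \<open>P\<close> is an
  ideal of itself; this is what makes it a subset of \<open>P\<close> and hence an ideal.\<close>

lemma generated_dg_ideal:
  assumes P: "dg_operad K P" and S: "\<And>n d. S n d \<subseteq> elts P n d"
  shows "dg_operadic_ideal K P (generated_dg_ideal K P S)"
    and "S n d \<subseteq> generated_dg_ideal K P S n d"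
    and "\<lbrakk>dg_operadic_ideal K P J; \<And>n d. S n d \<subseteq> J n d\<rbrakk> \<Longrightarrow> generated_dg_ideal K P S n d \<subseteq> J n d"
proof -
  interpret dg_operad K P by fact
  let ?\<J> = "{J. dg_operadic_ideal K P J \<and> (\<forall>n d. S n d \<subseteq> J n d)}"
  have gen: "generated_dg_ideal K P S n d = (\<Inter>J\<in>?\<J>. J n d)" for n d
    by (auto simp: generated_dg_ideal_def)
  have "dg_operadic_ideal K P (elts P)"
    unfolding dg_operadic_ideal_def
    using module.carrier_is_submodule[OF piece_module] linear_maps_closed[OF act_linear]
      linear_maps_closed[OF cmp_linear_right] linear_maps_closed[OF diff_linear]
    by blast
  then have top: "elts P \<in> ?\<J>"
    using S by blast
  have sub: "submodule (\<Inter>J\<in>?\<J>. J n d) K (piece P n d)" for n d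
  proof -
    interpret V: module K "piece P n d" by (rule piece_module)
    have "submodule (J n d) K (piece P n d)" if "J \<in> ?\<J>" for J
      using that by (simp add: dg_operadic_ideal_def)
    note J = V.submoduleE[OF this] submodule_zero[OF this]
    show ?thesis
    proof (rule V.submoduleI)
      show "(\<Inter>J\<in>?\<J>. J n d) \<subseteq> elts P n d"
        using top by blast
    qed (use J in \<open>simp_all\<close>)
  qed
  show "dg_operadic_ideal K P (generated_dg_ideal K P S)"
    unfolding dg_operadic_ideal_def
  proof (intro conjI allI ballI impI; (elim conjE)?)
    show "submodule (generated_dg_ideal K P S n d) K (piece P n d)" for n d
      unfolding gen by (rule sub)
  qed (auto simp: gen dg_operadic_ideal_def)
  show "S n d \<subseteq> generated_dg_ideal K P S n d"
    by (auto simp: gen)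
  show "\<lbrakk>dg_operadic_ideal K P J; \<And>n d. S n d \<subseteq> J n d\<rbrakk> \<Longrightarrow> generated_dg_ideal K P S n d \<subseteq> J n d"
    by (auto simp: gen)
qed

section \<open>Operads presented by generators and relations\<close>

text \<open>The conditions \<open>\<sigma> permutes {1..n}\<close> and the arities \<open>m + n - 1\<close> keep the literal form in which
  the rules for terms mention them only if \<open>1\<close> is not rewritten to a successor.\<close>

declare One_nat_def [simp del]

locale presentation = field K for K :: "('k, 'r) ring_scheme" (structure) +
  fixes G :: "nat \<Rightarrow> int \<Rightarrow> 'g set"
    and R :: "nat \<Rightarrow> int \<Rightarrow> ('k, 'g) opterm \<Rightarrow> ('k, 'g) opterm \<Rightarrow> bool"
begin

abbreviation "wft \<equiv> wf_term K G"
abbreviation "eqv \<equiv> op_eq K G R"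
abbreviation "cls \<equiv> term_class K G R"
abbreviation "T \<equiv> presented_operad K G R"

lemma wf_cmp': "\<lbrakk>wft m a s; wft n b t; 1 \<le> i; i \<le> m; N = m + n - 1; D = a + b\<rbrakk> \<Longrightarrow> wft N D (OCmp i s t)"
  using wf_cmp by blast

text \<open>The congruence only relates well-formed terms of the given arity and degree, so that an
  equivalence class determines both.  Arities and degrees of the two sides of an axiom agree only up to
  arithmetic, and truncated subtraction requires the bounds on the indices of the compositions.\<close>

lemma eqv_wf: "eqv n d s t \<Longrightarrow> wft n d s \<and> wft n d t"
proof (induction rule: op_eq.induct)
  case (oe_diff_diff n d t)
  then show ?case
    using wf_diff[OF wf_diff[OF oe_diff_diff]] by (simp add: wf_zero add.assoc)
next
  case (oe_unit_left n b t)
  then show ?case by (auto intro: wf_cmp'[OF wf_unit])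
next
  case (oe_unit_right i m a s)
  then show ?case by (auto intro: wf_cmp'[OF _ wf_unit])
next
  case (oe_cmp_sequential i m j n a s b t q c u)
  show ?case
    by (rule conjI; rule wf_cmp'[OF wf_cmp wf_cmp] wf_cmp'[OF wf_cmp] wf_cmp'[OF _ wf_cmp])
      (use oe_cmp_sequential in auto)
next
  case (oe_cmp_parallel i k m a s n b t q c u)
  have "wft (m + n + q - 2) (a + b + c) (OCmp (k + n - 1) (OCmp i s t) u)"
    by (rule wf_cmp'[of "m + n - 1" "a + b" _ q c]) (use oe_cmp_parallel in \<open>auto intro: wf_cmp'\<close>)
  moreover have "wft (m + n + q - 2) (a + b + c) (OCmp i (OCmp k s u) t)"
    by (rule wf_cmp'[of "m + q - 1" "a + c" _ n b]) (use oe_cmp_parallel in \<open>auto intro: wf_cmp'\<close>)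
  ultimately show ?case
    by (simp add: wf_smult ksign_closed)
next
  case (oe_cmp_act i m \<sigma> \<tau> n a s b t)
  have "\<sigma> i \<in> {1..m}"
    using oe_cmp_act permutes_in_image[of \<sigma> "{1..m}" i] by simp
  then show ?case
    using oe_cmp_act perm_cmp_permutes[of i m \<sigma> \<tau> n] by (auto intro!: wf_act wf_cmp)
next
  case (oe_diff_cmp i m a s n b t)
  have "wft (m + n - 1) (a + b + 1) (OCmp i (ODiff s) t)"
    by (rule wf_cmp'[OF wf_diff]) (use oe_diff_cmp in auto)
  moreover have "wft (m + n - 1) (a + b + 1) (OCmp i s (ODiff t))"
    by (rule wf_cmp'[OF _ wf_diff]) (use oe_diff_cmp in auto)
  moreover have "wft (m + n - 1) (a + b + 1) (ODiff (OCmp i s t))"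
    by (intro wf_diff wf_cmp) (use oe_diff_cmp in auto)
  ultimately show ?case
    by (simp add: wf_add wf_smult ksign_closed)
qed (auto intro: wf_term.intros permutes_compose)

lemma cls_eq_iff: "wft n d s \<Longrightarrow> cls n d s = cls n d t \<longleftrightarrow> eqv n d s t"
  unfolding term_class_def by (blast intro: oe_refl oe_sym oe_trans)

lemma cls_eqI: "eqv n d s t \<Longrightarrow> cls n d s = cls n d t"
  using cls_eq_iff eqv_wf by blast

lemma cls_UN:
  assumes "wft n d t" and "\<And>t'. eqv n d t t' \<Longrightarrow> F t = F t'"
  shows "(\<Union>t'\<in>cls n d t. F t') = F t"
  using assms oe_refl[of K G n d t R] unfolding term_class_def by blast

lemma elts_T: "elts T n d = cls n d ` {t. wft n d t}"
  and zero_T: "\<zero>\<^bsub>piece T n d\<^esub> = cls n d (OZero n d)"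
  and unit_T: "unit T = cls 1 0 OUnit"
  by (simp_all add: presented_operad_def)

lemma cls_closed: "wft n d t \<Longrightarrow> cls n d t \<in> elts T n d"
  and elts_TE: "X \<in> elts T n d \<Longrightarrow> (\<And>t. \<lbrakk>wft n d t; X = cls n d t\<rbrakk> \<Longrightarrow> thesis) \<Longrightarrow> thesis"
  by (auto simp: elts_T)

lemma add_T:
  assumes "wft n d s" "wft n d t"
  shows "cls n d s \<oplus>\<^bsub>piece T n d\<^esub> cls n d t = cls n d (OAdd s t)"
proof -
  have "(\<Union>t'\<in>cls n d t. cls n d (OAdd s' t')) = cls n d (OAdd s' t)" if "wft n d s'" for s'
    using that assms by (intro cls_UN cls_eqI oe_cong_add) (auto intro: oe_refl)
  then have "(\<Union>s'\<in>cls n d s. \<Union>t'\<in>cls n d t. cls n d (OAdd s' t')) = cls n d (OAdd s t)"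
    using assms eqv_wf
    by (subst cls_UN[of n d s]) (auto intro!: cls_eqI oe_cong_add intro: oe_refl)
  then show ?thesis by (simp add: presented_operad_def)
qed

lemma smult_T:
  assumes "c \<in> carrier K" "wft n d t"
  shows "c \<odot>\<^bsub>piece T n d\<^esub> cls n d t = cls n d (OSmult c t)"
  using cls_UN[of n d t "\<lambda>t. cls n d (OSmult c t)"] assms
  by (simp add: presented_operad_def cls_eqI oe_cong_smult)

lemma act_T:
  assumes "\<sigma> permutes {1..n}" "wft n d t"
  shows "act T n d \<sigma> (cls n d t) = cls n d (OAct \<sigma> t)"
  using cls_UN[of n d t "\<lambda>t. cls n d (OAct \<sigma> t)"] assms
  by (simp add: presented_operad_def cls_eqI oe_cong_act)

lemma diff_T:
  assumes "wft n d t"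
  shows "diff T n d (cls n d t) = cls n (d + 1) (ODiff t)"
  using cls_UN[of n d t "\<lambda>t. cls n (d + 1) (ODiff t)"] assms
  by (simp add: presented_operad_def cls_eqI oe_cong_diff)

lemma cmp_T:
  assumes i: "1 \<le> i" "i \<le> m" and "wft m a s" "wft n b t"
  shows "cmp T m a n b i (cls m a s) (cls n b t) = cls (m + n - 1) (a + b) (OCmp i s t)"
proof -
  let ?F = "\<lambda>s t. cls (m + n - 1) (a + b) (OCmp i s t)"
  have "(\<Union>t'\<in>cls n b t. ?F s' t') = ?F s' t" if "wft m a s'" for s'
    using that assms by (intro cls_UN cls_eqI oe_cong_cmp) (auto intro: oe_refl)
  then have "(\<Union>s'\<in>cls m a s. \<Union>t'\<in>cls n b t. ?F s' t') = ?F s t"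
    using assms eqv_wf
    by (subst cls_UN[of m a s]) (simp_all add: cls_eqI[OF oe_cong_cmp[OF i _ oe_refl]])
  then show ?thesis by (simp add: presented_operad_def)
qed

lemma piece_module_T: "module K (piece T n d)"
proof (intro moduleI abelian_groupI)
  show "cring K" by (rule is_cring)
  have neg: "eqv n d (OAdd (OSmult (\<ominus> \<one>) t) t) (OZero n d)" if t: "wft n d t" for t
  proof -
    have w: "wft n d (OSmult (\<ominus> \<one>) t)"
      using t by (intro wf_smult) auto
    have "eqv n d (OAdd (OSmult (\<ominus> \<one>) t) t) (OAdd (OSmult (\<ominus> \<one>) t) (OSmult \<one> t))"
      using w t by (intro oe_cong_add oe_refl oe_sym[OF oe_smult_one])
    moreover have "eqv n d (OAdd (OSmult (\<ominus> \<one>) t) (OSmult \<one> t)) (OSmult (\<ominus> \<one> \<oplus> \<one>) t)"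
      using t by (intro oe_sym[OF oe_smult_distr_left]) auto
    moreover have "eqv n d (OSmult (\<ominus> \<one> \<oplus> \<one>) t) (OZero n d)"
      using oe_smult_zero[OF t] by (simp add: l_neg)
    ultimately show ?thesis by (blast intro: oe_trans)
  qed
  fix X assume X: "X \<in> elts T n d"
  then obtain t where t: "wft n d t" "X = cls n d t" by (auto simp: elts_T)
  show "\<exists>Y \<in> elts T n d. Y \<oplus>\<^bsub>piece T n d\<^esub> X = \<zero>\<^bsub>piece T n d\<^esub>"
  proof
    show "cls n d (OSmult (\<ominus> \<one>) t) \<oplus>\<^bsub>piece T n d\<^esub> X = \<zero>\<^bsub>piece T n d\<^esub>"
      using neg[OF t(1)] t wf_smult[OF a_inv_closed[OF one_closed] t(1)] by (simp add: add_T zero_T cls_eqI)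
    show "cls n d (OSmult (\<ominus> \<one>) t) \<in> elts T n d"
      using t wf_smult[OF a_inv_closed[OF one_closed] t(1)] by (simp add: elts_T)
  qed
qed (auto elim!: elts_TE simp: cls_closed zero_T add_T smult_T wf_zero wf_add wf_smult cls_eq_iff del: equalityI
    intro: op_eq.intros)

lemma linear_maps_T:
  assumes F: "\<And>t. wft n d t \<Longrightarrow> F (cls n d t) = cls n' d' (f t)"
    and wf: "\<And>t. wft n d t \<Longrightarrow> wft n' d' (f t)"
    and add: "\<And>s t. \<lbrakk>wft n d s; wft n d t\<rbrakk> \<Longrightarrow> eqv n' d' (f (OAdd s t)) (OAdd (f s) (f t))"
    and smult: "\<And>c t. \<lbrakk>c \<in> carrier K; wft n d t\<rbrakk> \<Longrightarrow> eqv n' d' (f (OSmult c t)) (OSmult c (f t))"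
  shows "F \<in> linear_maps K (piece T n d) (piece T n' d')"
  by (rule linear_mapsI)
    (auto simp: elts_T F wf add_T smult_T wf_add wf_smult cls_eqI[OF add] cls_eqI[OF smult])

text \<open>Each axiom of a DG operad is one of the defining rules of the congruence, once the operations are
  evaluated on representatives.\<close>

lemma presented_dg_operad: "dg_operad K T"
proof -
  have smod: "dg_smodule K T"
  proof (intro dg_smodule.intro dg_smodule_axioms.intro)
    show "field K" by (rule field_axioms)
  next
    fix n :: nat and d and \<sigma> \<tau> :: "nat \<Rightarrow> nat" and X
    assume \<sigma>: "\<sigma> permutes {1..n}"
    show "act T n d \<sigma> \<in> linear_maps K (piece T n d) (piece T n d)"
      using \<sigma> by (intro linear_maps_T[where f = "OAct \<sigma>"]) (auto simp: act_T intro: wf_act oe_act_add oe_act_smult)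
    assume X: "X \<in> elts T n d"
    show "diff T n d (act T n d \<sigma> X) = act T n (d + 1) \<sigma> (diff T n d X)"
      using X \<sigma> by (auto simp: elts_T act_T diff_T wf_act wf_diff cls_eq_iff del: equalityI intro: oe_diff_act)
    assume \<tau>: "\<tau> permutes {1..n}"
    show "act T n d \<tau> (act T n d \<sigma> X) = act T n d (\<sigma> \<circ> \<tau>) X"
      using X \<sigma> \<tau> permutes_compose[OF \<tau> \<sigma>]
      by (auto simp: elts_T act_T wf_act cls_eq_iff del: equalityI intro: oe_act_act)
  next
    fix n :: nat and d :: int and X
    show "module K (piece T n d)" by (rule piece_module_T)
    show "diff T n d \<in> linear_maps K (piece T n d) (piece T n (d + 1))"
      by (intro linear_maps_T[where f = ODiff]) (auto simp: diff_T intro: wf_diff oe_diff_add oe_diff_smult)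
    assume X: "X \<in> elts T n d"
    show "act T n d id X = X"
      using X permutes_id[of "{1..n}"] by (auto simp: elts_T act_T wf_act cls_eq_iff del: equalityI intro: oe_act_id)
    show "diff T n (d + 1) (diff T n d X) = \<zero>\<^bsub>piece T n (d + 2)\<^esub>"
      using X by (auto simp: elts_T diff_T zero_T wf_diff add.assoc del: equalityI intro: cls_eqI[OF oe_diff_diff])
  qed
  show ?thesis
  proof (intro dg_operad.intro[OF smod] dg_operad_axioms.intro)
    show "unit T \<in> elts T 1 0"
      by (simp add: unit_T elts_T wf_unit)
  next
    fix i m n :: nat and b a :: int and Y
    assume i: "1 \<le> i" "i \<le> m" and "Y \<in> elts T n b"
    then obtain t where t: "wft n b t" "Y = cls n b t" by (auto simp: elts_T)
    show "(\<lambda>X. cmp T m a n b i X Y) \<in> linear_maps K (piece T m a) (piece T (m + n - 1) (a + b))"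
      unfolding t(2) using i t(1)
      by (intro linear_maps_T[where f = "\<lambda>s. OCmp i s t"])
        (auto simp: cmp_T intro: wf_cmp oe_cmp_add_left oe_cmp_smult_left)
  next
    fix i m n :: nat and a b :: int and X
    assume i: "1 \<le> i" "i \<le> m" and "X \<in> elts T m a"
    then obtain s where s: "wft m a s" "X = cls m a s" by (auto simp: elts_T)
    show "cmp T m a n b i X \<in> linear_maps K (piece T n b) (piece T (m + n - 1) (a + b))"
      unfolding s(2) using i s(1)
      by (intro linear_maps_T[where f = "OCmp i s"])
        (auto simp: cmp_T intro: wf_cmp oe_cmp_add_right oe_cmp_smult_right)
  next
    fix n :: nat and b :: int and Y
    assume "Y \<in> elts T n b"
    then obtain t where t: "wft n b t" "Y = cls n b t" by (auto simp: elts_T)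
    show "cmp T 1 0 n b 1 (unit T) Y = Y"
      using cmp_T[OF _ _ wf_unit t(1), of 1] cls_eqI[OF oe_unit_left[OF t(1)]] t(2) by (simp add: unit_T)
  next
    fix i m :: nat and a :: int and X
    assume i: "1 \<le> i" "i \<le> m" and "X \<in> elts T m a"
    then obtain s where s: "wft m a s" "X = cls m a s" by (auto simp: elts_T)
    show "cmp T m a 1 0 i X (unit T) = X"
      using cmp_T[OF i s(1) wf_unit] cls_eqI[OF oe_unit_right[OF i s(1)]] s(2) by (simp add: unit_T)
  next
    fix i m j n q :: nat and a b c :: int and X Y Z
    assume i: "1 \<le> i" "i \<le> m" and j: "1 \<le> j" "j \<le> n"
      and "X \<in> elts T m a" "Y \<in> elts T n b" "Z \<in> elts T q c"
    then obtain s t u where s: "wft m a s" "X = cls m a s"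
      and t: "wft n b t" "Y = cls n b t" and u: "wft q c u" "Z = cls q c u"
      by (auto simp: elts_T)
    have ij: "1 \<le> i + j - 1" "i + j - 1 \<le> m + n - 1" using i j by auto
    have e: "m + n - 1 + q - 1 = m + n + q - 2" "m + (n + q - 1) - 1 = m + n + q - 2"
      "a + (b + c) = a + b + c" using i j by auto
    show "cmp T (m + n - 1) (a + b) q c (i + j - 1) (cmp T m a n b i X Y) Z =
      cmp T m a (n + q - 1) (b + c) i X (cmp T n b q c j Y Z)"
      unfolding s(2) t(2) u(2) cmp_T[OF i s(1) t(1)] cmp_T[OF j t(1) u(1)]
        cmp_T[OF ij wf_cmp[OF i s(1) t(1)] u(1)] cmp_T[OF i s(1) wf_cmp[OF j t(1) u(1)]] e
      by (rule cls_eqI[OF oe_cmp_sequential[OF i j s(1) t(1) u(1)]])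
  next
    fix i k m n q :: nat and a b c :: int and X Y Z
    assume ik: "1 \<le> i" "i < k" "k \<le> m"
      and "X \<in> elts T m a" "Y \<in> elts T n b" "Z \<in> elts T q c"
    then obtain s t u where s: "wft m a s" "X = cls m a s"
      and t: "wft n b t" "Y = cls n b t" and u: "wft q c u" "Z = cls q c u"
      by (auto simp: elts_T)
    have i: "1 \<le> i" "i \<le> m" and k: "1 \<le> k" "k \<le> m"
      and kn: "1 \<le> k + n - 1" "k + n - 1 \<le> m + n - 1" and i': "i \<le> m + q - 1" using ik by auto
    have e: "m + n - 1 + q - 1 = m + n + q - 2" "m + q - 1 + n - 1 = m + n + q - 2"
      "a + c + b = a + b + c" using ik by auto
    note w = wf_cmp[OF i(1) i' wf_cmp[OF k s(1) u(1)] t(1), unfolded e]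
    show "cmp T (m + n - 1) (a + b) q c (k + n - 1) (cmp T m a n b i X Y) Z =
       ksign K (b * c) \<odot>\<^bsub>piece T (m + n + q - 2) (a + b + c)\<^esub>
       cmp T (m + q - 1) (a + c) n b i (cmp T m a q c k X Z) Y"
      unfolding s(2) t(2) u(2) cmp_T[OF i s(1) t(1)] cmp_T[OF k s(1) u(1)]
        cmp_T[OF kn wf_cmp[OF i s(1) t(1)] u(1)]
        cmp_T[OF i(1) i' wf_cmp[OF k s(1) u(1)] t(1)] e smult_T[OF ksign_closed w]
      by (rule cls_eqI[OF oe_cmp_parallel[OF ik s(1) t(1) u(1)]])
  next
    fix i m n :: nat and a b :: int and \<sigma> \<tau> :: "nat \<Rightarrow> nat" and X Y
    assume i: "1 \<le> i" "i \<le> m" and \<sigma>: "\<sigma> permutes {1..m}" and \<tau>: "\<tau> permutes {1..n}"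
      and "X \<in> elts T m a" "Y \<in> elts T n b"
    then obtain s t where s: "wft m a s" "X = cls m a s" and t: "wft n b t" "Y = cls n b t"
      by (auto simp: elts_T)
    have si: "1 \<le> \<sigma> i" "\<sigma> i \<le> m" using permutes_in_image[OF \<sigma>, of i] i by auto
    note pc = perm_cmp_permutes[OF i \<sigma> \<tau>]
    show "cmp T m a n b i (act T m a \<sigma> X) (act T n b \<tau> Y) =
       act T (m + n - 1) (a + b) (perm_cmp n i \<sigma> \<tau>) (cmp T m a n b (\<sigma> i) X Y)"
      unfolding s(2) t(2) act_T[OF \<sigma> s(1)] act_T[OF \<tau> t(1)] cmp_T[OF si s(1) t(1)]
        cmp_T[OF i wf_act[OF \<sigma> s(1)] wf_act[OF \<tau> t(1)]] act_T[OF pc wf_cmp[OF si s(1) t(1)]]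
      by (rule cls_eqI[OF oe_cmp_act[OF i \<sigma> \<tau> s(1) t(1)]])
  next
    fix i m n :: nat and a b :: int and X Y
    assume i: "1 \<le> i" "i \<le> m" and "X \<in> elts T m a" "Y \<in> elts T n b"
    then obtain s t where s: "wft m a s" "X = cls m a s" and t: "wft n b t" "Y = cls n b t"
      by (auto simp: elts_T)
    have e: "a + 1 + b = a + b + 1" "a + (b + 1) = a + b + 1" by auto
    note ds = wf_diff[OF s(1)] and dt = wf_diff[OF t(1)]
    note c1 = wf_cmp[OF i ds t(1), unfolded e] and c2 = wf_cmp[OF i s(1) dt, unfolded e]
    show "diff T (m + n - 1) (a + b) (cmp T m a n b i X Y) =
       cmp T m (a + 1) n b i (diff T m a X) Y \<oplus>\<^bsub>piece T (m + n - 1) (a + b + 1)\<^esub>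
       ksign K a \<odot>\<^bsub>piece T (m + n - 1) (a + b + 1)\<^esub> cmp T m a n (b + 1) i X (diff T n b Y)"
      unfolding s(2) t(2) cmp_T[OF i s(1) t(1)] diff_T[OF wf_cmp[OF i s(1) t(1)]]
        diff_T[OF s(1)] diff_T[OF t(1)] cmp_T[OF i ds t(1)] cmp_T[OF i s(1) dt] e
        smult_T[OF ksign_closed c2] add_T[OF c1 wf_smult[OF ksign_closed c2]]
      by (rule cls_eqI[OF oe_diff_cmp[OF i s(1) t(1)]])
  qed
qed

end

section \<open>Strong deformation retractions and quotients\<close>

lemma dg_operad_homD:
  assumes "dg_operad_hom K A B f"
  shows "f n d \<in> linear_maps K (piece A n d) (piece B n d)"
    and "\<lbrakk>\<sigma> permutes {1..n}; x \<in> elts A n d\<rbrakk> \<Longrightarrow> f n d (act A n d \<sigma> x) = act B n d \<sigma> (f n d x)"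
    and "x \<in> elts A n d \<Longrightarrow> f n (d + 1) (diff A n d x) = diff B n d (f n d x)"
    and "f 1 0 (unit A) = unit B"
    and "\<lbrakk>1 \<le> i; i \<le> m; x \<in> elts A m a; y \<in> elts A n b\<rbrakk> \<Longrightarrow>
      f (m + n - 1) (a + b) (cmp A m a n b i x y) = cmp B m a n b i (f m a x) (f n b y)"
  using assms by (auto simp: dg_operad_hom_def graded_maps_def equivariant_def)

lemma dg_operad_hom_diff:
  assumes "dg_operad_hom K A B f" and "x \<in> elts A n (d - 1)"
  shows "f n d (diff A n (d - 1) x) = diff B n (d - 1) (f n (d - 1) x)"
  using dg_operad_homD(3)[OF assms] by simp

lemma kernel_dg_ideal:
  assumes A: "dg_operad K A" and B: "dg_operad K B" and f: "dg_operad_hom K A B f"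
  shows "dg_operadic_ideal K A (\<lambda>n d. {x \<in> elts A n d. f n d x = \<zero>\<^bsub>piece B n d\<^esub>})"
proof -
  interpret A: dg_operad K A by fact
  interpret B: dg_operad K B by fact
  note f_lin = dg_operad_homD(1)[OF f] and f_act = dg_operad_homD(2)[OF f]
    and f_diff = dg_operad_homD(3)[OF f] and f_cmp = dg_operad_homD(5)[OF f]
  note zero = linear_maps_zero[OF B.piece_module B.piece_module]
  have zB: "\<zero>\<^bsub>piece B n d\<^esub> \<in> elts B n d" for n d
    by (rule submodule_zero[OF module.carrier_is_submodule[OF B.piece_module]])
  have fc: "f n d x \<in> elts B n d" if "x \<in> elts A n d" for n d x
    using linear_maps_closed[OF f_lin that] .
  have sub: "submodule {x \<in> elts A n d. f n d x = \<zero>\<^bsub>piece B n d\<^esub>} K (piece A n d)" for n d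
  proof -
    interpret V: module K "piece A n d" by (rule A.piece_module)
    interpret W: module K "piece B n d" by (rule B.piece_module)
    show ?thesis
      by (rule V.submoduleI)
        (auto simp: linear_maps_add[OF f_lin] linear_maps_smult[OF f_lin]
          linear_maps_uminus[OF A.piece_module B.piece_module f_lin]
          linear_maps_zero[OF A.piece_module B.piece_module f_lin])
  qed
  have cmp: "cmp A m a n b i x y \<in> elts A (m + n - 1) (a + b)"
    and left: "f m a x = \<zero>\<^bsub>piece B m a\<^esub> \<Longrightarrow>
      f (m + n - 1) (a + b) (cmp A m a n b i x y) = \<zero>\<^bsub>piece B (m + n - 1) (a + b)\<^esub>"
    and right: "f n b y = \<zero>\<^bsub>piece B n b\<^esub> \<Longrightarrow>
      f (m + n - 1) (a + b) (cmp A m a n b i x y) = \<zero>\<^bsub>piece B (m + n - 1) (a + b)\<^esub>"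
    if i: "1 \<le> i" "i \<le> m" and x: "x \<in> elts A m a" and y: "y \<in> elts A n b" for m n a b i x y
    using linear_maps_closed[OF A.cmp_linear_right[OF i x] y]
      zero[OF B.cmp_linear_left[OF i fc[OF y]]] zero[OF B.cmp_linear_right[OF i fc[OF x]]]
    by (simp_all add: f_cmp[OF i x y])
  show ?thesis
    unfolding dg_operadic_ideal_def
    using sub linear_maps_closed[OF A.act_linear] linear_maps_closed[OF A.diff_linear]
      zero[OF B.act_linear] zero[OF B.diff_linear]
    by (simp add: f_act f_diff cmp left right)
qed

text \<open>The maps \<open>p\<close> and \<open>H\<close> descend to the quotient and exhibit \<open>A\<close> as a deformation retract of it.
  On representatives: if \<open>i x - d y\<close> lies in the ideal, then applying \<open>p\<close> gives \<open>x = d (p y)\<close>; and if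
  \<open>d y\<close> lies in the ideal, then so does \<open>H (d y)\<close>, whence \<open>y - i (p y)\<close> is congruent to \<open>d (H y)\<close>.\<close>

lemma (in dg_ideal) sdr_quotient_quasi_iso:
  assumes A: "dg_operad K A" and sdr: "operad_sdr K P A i p H"
    and p: "\<And>n d x. x \<in> I n d \<Longrightarrow> p n d x = \<zero>\<^bsub>piece A n d\<^esub>"
    and H: "\<And>n d x. x \<in> I n d \<Longrightarrow> H n d x \<in> I n (d - 1)"
  shows "operad_quasi_iso K A Q (\<lambda>n d x. proj n d (i n d x))"
proof -
  interpret A: dg_operad K A by fact
  interpret Q: dg_operad K Q by (rule quot_dg_operad)
  have i_hom: "dg_operad_hom K A P i" and p_hom: "dg_operad_hom K P A p"
    and pi: "\<And>n d x. x \<in> elts A n d \<Longrightarrow> p n d (i n d x) = x"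
    and H_maps: "H \<in> graded_maps K P P (-1)"
    and homotopy: "\<And>n d x. x \<in> elts P n d \<Longrightarrow>
      diff P n (d - 1) (H n d x) \<oplus>\<^bsub>piece P n d\<^esub> H n (d + 1) (diff P n d x) =
      x \<ominus>\<^bsub>piece P n d\<^esub> i n d (p n d x)"
    using sdr by (auto simp: operad_sdr_def)
  note i_lin = dg_operad_homD(1)[OF i_hom] and p_lin = dg_operad_homD(1)[OF p_hom]
  have H_lin: "H n d \<in> linear_maps K (piece P n d) (piece P n (d - 1))" for n d
    using H_maps by (simp add: graded_maps_def)
  have hom: "dg_operad_hom K A Q (\<lambda>n d x. proj n d (i n d x))"
    by (rule dg_operad_hom_comp[OF i_hom proj_hom])
  have inj: "x \<in> coboundaries A n d"
    if x: "x \<in> cocycles A n d" and b: "proj n d (i n d x) \<in> coboundaries Q n d" for n d x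
  proof -
    interpret VA: module K "piece A n d" by (rule A.piece_module)
    have xA: "x \<in> elts A n d" using x by (simp add: cocycles_def)
    note ix = linear_maps_closed[OF i_lin xA]
    obtain y where y: "y \<in> elts P n (d - 1)" "proj n d (i n d x) = diff Q n (d - 1) (proj n (d - 1) y)"
      using b by (auto simp: coboundaries_def elts_Q)
    note dy = linear_maps_closed[OF diff_linear' y(1)]
    note py = linear_maps_closed[OF p_lin y(1)]
    have "proj n d (i n d x) = proj n d (diff P n (d - 1) y)"
      using y diff_Q[OF y(1)] by simp
    then have "i n d x \<ominus>\<^bsub>piece P n d\<^esub> diff P n (d - 1) y \<in> I n d"
      using proj_eq_iff[OF ix dy] by simp
    then have "p n d (i n d x \<ominus>\<^bsub>piece P n d\<^esub> diff P n (d - 1) y) = \<zero>\<^bsub>piece A n d\<^esub>"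
      by (rule p)
    then have "x \<ominus>\<^bsub>piece A n d\<^esub> diff A n (d - 1) (p n (d - 1) y) = \<zero>\<^bsub>piece A n d\<^esub>"
      using linear_maps_minus[OF piece_module A.piece_module p_lin ix dy]
      by (simp add: pi[OF xA] dg_operad_hom_diff[OF p_hom y(1)])
    then have "x = diff A n (d - 1) (p n (d - 1) y)"
      by (rule module_minus_eq_zeroD[OF A.piece_module _ xA linear_maps_closed[OF A.diff_linear' py]])
    then show ?thesis
      using py by (auto simp: coboundaries_def)
  qed
  have surj: "\<exists>x \<in> cocycles A n d. Y \<ominus>\<^bsub>piece Q n d\<^esub> proj n d (i n d x) \<in> coboundaries Q n d"
    if Y: "Y \<in> cocycles Q n d" for n d Y
  proof -
    interpret V: module K "piece P n d" by (rule piece_module)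
    obtain y where y: "y \<in> elts P n d" "Y = proj n d y"
      using Y by (auto simp: cocycles_def elts_Q)
    note dy = linear_maps_closed[OF diff_linear y(1)]
    have "proj n (d + 1) (diff P n d y) = \<zero>\<^bsub>piece Q n (d + 1)\<^esub>"
      using Y y diff_Q[OF y(1)] by (simp add: cocycles_def)
    then have dyI: "diff P n d y \<in> I n (d + 1)"
      using proj_eq_zero_iff[OF dy] by simp
    note py = linear_maps_closed[OF p_lin y(1)] and Hy = linear_maps_closed[OF H_lin y(1)]
    note ipy = linear_maps_closed[OF i_lin py] and dHy = linear_maps_closed[OF diff_linear' Hy]
    have "p n d y \<in> cocycles A n d"
      using py p[OF dyI] dg_operad_homD(3)[OF p_hom y(1)] by (simp add: cocycles_def)
    have HdyI: "H n (d + 1) (diff P n d y) \<in> I n d"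
      using H[OF dyI] by simp
    note Hdy = ideal_carrier[OF HdyI]
    have "Y \<ominus>\<^bsub>piece Q n d\<^esub> proj n d (i n d (p n d y)) = proj n d (y \<ominus>\<^bsub>piece P n d\<^esub> i n d (p n d y))"
      unfolding y(2) using linear_maps_minus[OF piece_module piece_module_Q proj_linear y(1) ipy] by simp
    also have "\<dots> = proj n d (diff P n (d - 1) (H n d y) \<oplus>\<^bsub>piece P n d\<^esub> H n (d + 1) (diff P n d y))"
      by (simp add: homotopy[OF y(1)])
    also have "\<dots> = proj n d (diff P n (d - 1) (H n d y))"
      using HdyI Hdy dHy by (subst proj_eq_iff) (auto simp: module_add_minus_cancel[OF piece_module])
    also have "\<dots> = diff Q n (d - 1) (proj n (d - 1) (H n d y))"
      using diff_Q[OF Hy] by simp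
    also have "\<dots> \<in> coboundaries Q n d"
      using Hy by (auto simp: coboundaries_def elts_Q)
    finally show ?thesis
      using \<open>p n d y \<in> cocycles A n d\<close> by blast
  qed
  show ?thesis
    unfolding operad_quasi_iso_def
    using quasi_iso_criterion[OF A.dg_smodule_axioms Q.dg_smodule_axioms dg_operad_homD(1)[OF hom]
        dg_operad_homD(3)[OF hom] inj surj] A.dg_operad_axioms Q.dg_operad_axioms hom
    by blast
qed

section \<open>Generators of presented operads\<close>

definition dg_suboperad :: "('k, 'r) ring_scheme \<Rightarrow> ('k, 'a, 'm) operad_scheme \<Rightarrow>
    (nat \<Rightarrow> int \<Rightarrow> 'a set) \<Rightarrow> bool"
  where "dg_suboperad K P W \<longleftrightarrow>
    (\<forall>n d. submodule (W n d) K (piece P n d)) \<and> unit P \<in> W 1 0 \<and>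
    (\<forall>n d \<sigma>. \<forall>x \<in> W n d. \<sigma> permutes {1..n} \<longrightarrow> act P n d \<sigma> x \<in> W n d) \<and>
    (\<forall>n d. \<forall>x \<in> W n d. diff P n d x \<in> W n (d + 1)) \<and>
    (\<forall>m a n b i. \<forall>x \<in> W m a. \<forall>y \<in> W n b. 1 \<le> i \<and> i \<le> m \<longrightarrow>
      cmp P m a n b i x y \<in> W (m + n - 1) (a + b))"

text \<open>The induction principle of a presented operad.  The morphism \<open>f\<close> is included because the
  coproduct is presented by all elements of its two factors: to reach the elements that come from the
  free operad, the principle is applied first to the free operad and its morphism to the coproduct.\<close>

lemma (in presentation) presented_operad_generated:
  assumes P: "dg_operad K P" and f: "dg_operad_hom K T P f" and W: "dg_suboperad K P W"
    and gen: "\<And>n d g. g \<in> G n d \<Longrightarrow> f n d (cls n d (OGen n d g)) \<in> W n d"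
    and X: "X \<in> elts T n d"
  shows "f n d X \<in> W n d"
proof -
  interpret P: dg_operad K P by fact
  have sub: "submodule (W n d) K (piece P n d)" for n d
    using W by (simp add: dg_suboperad_def)
  note W' = module.submoduleE(4,5)[OF P.piece_module sub] submodule_zero[OF sub]
  note f_lin = dg_operad_homD(1)[OF f]
  have "f n d (cls n d t) \<in> W n d" if "wft n d t" for t
    using that
  proof induction
    case (wf_gen g n d)
    then show ?case by (rule gen)
  next
    case wf_unit
    then show ?case
      using dg_operad_homD(4)[OF f] W by (simp add: unit_T[symmetric] dg_suboperad_def)
  next
    case (wf_zero n d)
    then show ?case
      using linear_maps_zero[OF piece_module_T P.piece_module f_lin] W'(3)
      by (simp add: zero_T[symmetric])
  next
    case (wf_add n d s t)
    then show ?case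
      using linear_maps_add[OF f_lin cls_closed cls_closed] W'(2) by (simp add: add_T[symmetric])
  next
    case (wf_smult c n d t)
    then show ?case
      using linear_maps_smult[OF f_lin _ cls_closed] W'(1) by (simp add: smult_T[symmetric])
  next
    case (wf_act \<sigma> n d t)
    then show ?case
      using dg_operad_homD(2)[OF f _ cls_closed] W by (simp add: act_T[symmetric] dg_suboperad_def)
  next
    case (wf_diff n d t)
    then show ?case
      using dg_operad_homD(3)[OF f cls_closed] W by (simp add: diff_T[symmetric] dg_suboperad_def)
  next
    case (wf_cmp i m a s n b t)
    then show ?case
      using dg_operad_homD(5)[OF f _ _ cls_closed cls_closed] W
      by (simp add: cmp_T[symmetric] dg_suboperad_def)
  qed
  then show ?thesis
    using X by (auto elim: elts_TE)
qed

context presentation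
begin

lemma smodule_generators:
  assumes M: "dg_smodule K M" and gen: "\<And>n d x. x \<in> elts M n d \<Longrightarrow> \<iota> x \<in> G n d"
    and rel: "\<And>n d s t. smodule_rels K M \<iota> n d s t \<Longrightarrow> R n d s t"
  shows "(\<lambda>n d x. cls n d (OGen n d (\<iota> x))) \<in> graded_maps K M T 0"
    and "x \<in> elts M n d \<Longrightarrow>
      cls n (d + 1) (OGen n (d + 1) (\<iota> (diff M n d x))) = diff T n d (cls n d (OGen n d (\<iota> x)))"
proof -
  interpret M: dg_smodule K M by fact
  have wf: "wft n d (OGen n d (\<iota> x))" if "x \<in> elts M n d" for n d x
    using that by (intro wf_gen gen)
  note rel' = cls_eqI[OF oe_rel[OF rel]]
  have lin: "(\<lambda>x. cls n d (OGen n d (\<iota> x))) \<in> linear_maps K (piece M n d) (piece T n d)" for n d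
  proof -
    interpret V: module K "piece M n d" by (rule M.piece_module)
    show ?thesis
      by (rule linear_mapsI)
        (simp_all add: wf cls_closed add_T smult_T wf_add wf_smult rel' smodule_rels.intros)
  qed
  have act: "cls n d (OGen n d (\<iota> (act M n d \<sigma> x))) = act T n d \<sigma> (cls n d (OGen n d (\<iota> x)))"
    if "\<sigma> permutes {1..n}" "x \<in> elts M n d" for n d \<sigma> x
    using that linear_maps_closed[OF M.act_linear[OF that(1)] that(2)]
    by (simp add: act_T wf wf_act rel' smodule_rels.intros)
  show "(\<lambda>n d x. cls n d (OGen n d (\<iota> x))) \<in> graded_maps K M T 0"
    using lin act by (simp add: graded_maps_def equivariant_def)
  show "cls n (d + 1) (OGen n (d + 1) (\<iota> (diff M n d x))) = diff T n d (cls n d (OGen n d (\<iota> x)))"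
    if "x \<in> elts M n d" for x
    using that linear_maps_closed[OF M.diff_linear that]
    by (simp add: diff_T wf wf_diff rel' smodule_rels.intros)
qed

lemma operad_generators:
  assumes A: "dg_operad K A" and gen: "\<And>n d x. x \<in> elts A n d \<Longrightarrow> \<iota> x \<in> G n d"
    and rel: "\<And>n d s t. operad_rels K A \<iota> n d s t \<Longrightarrow> R n d s t"
  shows "dg_operad_hom K A T (\<lambda>n d x. cls n d (OGen n d (\<iota> x)))"
proof -
  interpret A: dg_operad K A by fact
  have wf: "wft n d (OGen n d (\<iota> x))" if "x \<in> elts A n d" for n d x
    using that by (intro wf_gen gen)
  note rel' = cls_eqI[OF oe_rel[OF rel]]
  note smod = smodule_generators[where \<iota> = \<iota>, OF A.dg_smodule_axioms gen rel[OF operad_rels.intros(1)]]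
  have unit: "cls 1 0 (OGen 1 0 (\<iota> (unit A))) = unit T"
    unfolding unit_T by (rule rel'[OF operad_rels.intros(2) wf[OF A.unit_closed] wf_unit])
  have cmp: "cls (m + n - 1) (a + b) (OGen (m + n - 1) (a + b) (\<iota> (cmp A m a n b i x y))) =
      cmp T m a n b i (cls m a (OGen m a (\<iota> x))) (cls n b (OGen n b (\<iota> y)))"
    if i: "1 \<le> i" "i \<le> m" and x: "x \<in> elts A m a" and y: "y \<in> elts A n b" for m n a b i x y
    unfolding cmp_T[OF i wf[OF x] wf[OF y]]
    by (rule rel'[OF operad_rels.intros(3)[OF i x y] wf wf_cmp[OF i wf[OF x] wf[OF y]]])
      (rule linear_maps_closed[OF A.cmp_linear_right[OF i x] y])
  show ?thesis
    using smod unit cmp by (simp add: dg_operad_hom_def)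
qed

end

section \<open>Weights\<close>

text \<open>Spans are used to pass from homogeneous elements to all elements, so bilinearity of the
  composition is needed in the form of a principle for pairs of spans.\<close>

lemma (in dg_operad) cmp_generate:
  assumes i: "1 \<le> i" "i \<le> m" and A: "A \<subseteq> elts P m a" and B: "B \<subseteq> elts P n b"
    and N: "submodule N K (piece P (m + n - 1) (a + b))"
    and AB: "\<And>x y. \<lbrakk>x \<in> A; y \<in> B\<rbrakk> \<Longrightarrow> cmp P m a n b i x y \<in> N"
    and x: "x \<in> generate (add_monoid (piece P m a)) A"
    and y: "y \<in> generate (add_monoid (piece P n b)) B"
  shows "cmp P m a n b i x y \<in> N"
proof -
  interpret V: module K "piece P n b" by (rule piece_module)
  have yP: "y \<in> elts P n b"
    using V.M.add.generate_in_carrier[of B y] B y by simp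
  have "cmp P m a n b i x' y \<in> N" if x': "x' \<in> A" for x'
    using x' A by (intro linear_image_generate[OF piece_module piece_module
          cmp_linear_right[OF i] N B AB[OF x'] y]) auto
  then show ?thesis
    by (rule linear_image_generate[OF piece_module piece_module cmp_linear_left[OF i yP] N A _ x])
qed

locale adjoined_operad = Op: dg_operad K Op + C: dg_smodule K C
  for K :: "('k, 'r) ring_scheme" (structure)
    and Op :: "('k, 'o, 'm) operad_scheme" and C :: "('k, 'c, 'n) smodule_scheme"
begin

abbreviation "F \<equiv> free_operad K C"
abbreviation "P \<equiv> adjoin K Op C"
abbreviation "weight \<equiv> has_weight K Op C"
abbreviation "inl \<equiv> adjoin_inl K Op C"
abbreviation "gen \<equiv> adjoin_gen K Op C"

sublocale F: presentation K "elts C" "smodule_rels K C id" ..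
sublocale T: presentation K "coprod_gens Op F" "coprod_rels K Op F" ..

lemma F_eq: "F = F.T" and P_eq: "P = T.T"
  by (simp_all add: free_operad_def adjoin_def operad_coprod_def)

lemma F_dg_operad: "dg_operad K F"
  unfolding F_eq by (rule F.presented_dg_operad)

sublocale P: dg_operad K P
  unfolding P_eq by (rule T.presented_dg_operad)

lemma inl_hom: "dg_operad_hom K Op P inl"
  unfolding P_eq adjoin_inl_def coprod_inl_def
  by (rule T.operad_generators[OF Op.dg_operad_axioms]) (auto simp: coprod_gens_def coprod_rels_def)

lemma inr_hom: "dg_operad_hom K F P (coprod_inr K Op F)"
  unfolding P_eq coprod_inr_def
  by (rule T.operad_generators[OF F_dg_operad]) (auto simp: coprod_gens_def coprod_rels_def)

lemma free_gen_maps: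
  shows "free_gen K C n d \<in> linear_maps K (piece C n d) (piece F n d)"
    and "x \<in> elts C n d \<Longrightarrow> free_gen K C n (d + 1) (diff C n d x) = diff F n d (free_gen K C n d x)"
  using F.smodule_generators[OF C.dg_smodule_axioms, of id]
  unfolding F_eq free_gen_def by (simp_all add: graded_maps_def)

lemma gen_closed: "x \<in> elts C n d \<Longrightarrow> gen n d x \<in> elts P n d"
  and gen_diff: "x \<in> elts C n d \<Longrightarrow> diff P n d (gen n d x) = gen n (d + 1) (diff C n d x)"
  unfolding adjoin_gen_def
  using linear_maps_closed[OF free_gen_maps(1), of x n d] linear_maps_closed[OF dg_operad_homD(1)[OF inr_hom]]
    dg_operad_homD(3)[OF inr_hom, of "free_gen K C n d x" n d] free_gen_maps(2)[of x n d]
  by simp_all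

lemma inl_closed: "x \<in> elts Op n d \<Longrightarrow> inl n d x \<in> elts P n d"
  by (rule linear_maps_closed[OF dg_operad_homD(1)[OF inl_hom]])

lemma weight_closed: "weight w n d x \<Longrightarrow> x \<in> elts P n d"
proof (induction rule: has_weight.induct)
  case (weight_zero w n d)
  then show ?case by (rule submodule_zero[OF module.carrier_is_submodule[OF P.piece_module]])
next
  case (weight_add w n d x y)
  interpret V: module K "piece P n d" by (rule P.piece_module)
  show ?case using weight_add by simp
next
  case (weight_smult c w n d x)
  then show ?case using module.smult_closed[OF P.piece_module] by blast
next
  case (weight_act \<sigma> n w d x)
  then show ?case using linear_maps_closed[OF P.act_linear] by blast
qed (auto intro: inl_closed gen_closed P.cmp_closed)

text \<open>The differential is not among the operations that generate the homogeneous elements: it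
  preserves the weight since it does so on \<open>Op\<close> and on \<open>C\<close> and is a derivation.\<close>

lemma weight_diff: "weight w n d x \<Longrightarrow> weight w n (d + 1) (diff P n d x)"
proof (induction rule: has_weight.induct)
  case (weight_inl x n d)
  then show ?case
    using has_weight.weight_inl[OF linear_maps_closed[OF Op.diff_linear]] dg_operad_homD(3)[OF inl_hom]
    by metis
next
  case (weight_gen x n d)
  then show ?case
    using has_weight.weight_gen[OF linear_maps_closed[OF C.diff_linear]] by (simp add: gen_diff)
next
  case (weight_zero w n d)
  then show ?case
    by (simp add: linear_maps_zero[OF P.piece_module P.piece_module P.diff_linear] has_weight.weight_zero)
next
  case (weight_add w n d x y)
  then show ?case
    by (simp add: linear_maps_add[OF P.diff_linear] weight_closed has_weight.weight_add)
next
  case (weight_smult c w n d x)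
  then show ?case
    by (simp add: linear_maps_smult[OF P.diff_linear] weight_closed has_weight.weight_smult)
next
  case (weight_act \<sigma> n w d x)
  then show ?case
    by (simp add: P.diff_act weight_closed has_weight.weight_act)
next
  case (weight_cmp i m v a x w n b y)
  have e: "a + 1 + b = a + b + 1" "a + (b + 1) = a + b + 1" by auto
  have "ksign K a \<in> carrier K" by (rule Op.ksign_closed)
  then show ?case
    using has_weight.weight_cmp[OF weight_cmp(1,2) weight_cmp(5,4)]
      has_weight.weight_cmp[OF weight_cmp(1,2) weight_cmp(3,6)] weight_cmp(1-4)
    unfolding e by (simp add: P.diff_cmp weight_closed has_weight.weight_add has_weight.weight_smult)
qed

abbreviation "homogeneous n d \<equiv> {x. \<exists>w. weight w n d x}"

lemma homogeneous_closed: "homogeneous n d \<subseteq> elts P n d"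
  by (auto intro: weight_closed)

text \<open>The weight grading exhausts the operad: the spans of the homogeneous elements form a sub-DG-operad
  that contains \<open>Op\<close> and \<open>C\<close>, hence the image of the free operad on \<open>C\<close>, hence everything.\<close>

lemma homogeneous_span:
  assumes "x \<in> elts P n d"
  shows "x \<in> generate (add_monoid (piece P n d)) (homogeneous n d)"
proof -
  let ?W = "\<lambda>n d. generate (add_monoid (piece P n d)) (homogeneous n d)"
  have sub: "submodule (?W n d) K (piece P n d)" for n d
    by (rule submodule_generate[OF P.piece_module homogeneous_closed]) (auto intro: weight_smult)
  have incl: "x \<in> ?W n d" if "weight w n d x" for w n d x
    using that by (intro generate.incl) auto
  have act: "act P n d \<sigma> x \<in> ?W n d" if "\<sigma> permutes {1..n}" "x \<in> ?W n d" for n d \<sigma> x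
    by (rule linear_image_generate[OF P.piece_module P.piece_module P.act_linear[OF that(1)] sub
          homogeneous_closed _ that(2)]) (use that(1) in \<open>auto intro: incl weight_act\<close>)
  have diff: "diff P n d x \<in> ?W n (d + 1)" if "x \<in> ?W n d" for n d x
    by (rule linear_image_generate[OF P.piece_module P.piece_module P.diff_linear sub
          homogeneous_closed _ that]) (auto intro: incl weight_diff)
  have cmp: "cmp P m a n b i x y \<in> ?W (m + n - 1) (a + b)"
    if "1 \<le> i" "i \<le> m" "x \<in> ?W m a" "y \<in> ?W n b" for m a n b i x y
    by (rule P.cmp_generate[OF that(1,2) homogeneous_closed homogeneous_closed sub _ that(3,4)])
      (use that(1,2) in \<open>auto intro: incl weight_cmp\<close>)
  have inl: "inl n d x \<in> ?W n d" if "x \<in> elts Op n d" for n d x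
    using that by (intro incl[OF weight_inl])
  have "unit P \<in> ?W 1 0"
    using inl[OF Op.unit_closed] dg_operad_homD(4)[OF inl_hom] by simp
  then have W: "dg_suboperad K P ?W"
    using sub act diff cmp by (simp add: dg_suboperad_def)
  have inr: "coprod_inr K Op F n d g \<in> ?W n d" if "g \<in> elts F n d" for n d g
    using F.presented_operad_generated[OF P.dg_operad_axioms _ W, folded F_eq, OF inr_hom _ that]
      incl[OF weight_gen] by (simp add: adjoin_gen_def free_gen_def)
  have id: "dg_operad_hom K P P (\<lambda>n d x. x)"
    by (simp add: dg_operad_hom_def graded_maps_def linear_maps_def equivariant_def)
  show ?thesis
  proof (rule T.presented_operad_generated[OF P.dg_operad_axioms _ W, folded P_eq, OF id _ assms])
    fix n d g assume "g \<in> coprod_gens Op F n d"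
    then show "T.cls n d (OGen n d g) \<in> ?W n d"
      using inl inr by (auto simp: coprod_gens_def adjoin_inl_def coprod_inl_def coprod_inr_def)
  qed
qed

section \<open>Ideals generated in positive weight\<close>

text \<open>Characteristic zero makes the denominators of the derivation formula invertible; the inverse of
  zero need not lie in the carrier.\<close>

lemma weight_ratio_closed:
  assumes "\<And>n::nat. n > 0 \<Longrightarrow> [n] \<cdot> \<one> \<noteq> \<zero>"
  shows "weight_ratio K v t \<in> carrier K"
proof -
  have "inv ([t] \<cdot> \<one>) \<in> carrier K" if "t > 0"
    using assms[OF that] Op.field_Units by auto
  then show ?thesis
    by (auto simp: weight_ratio_def)
qed

lemma retraction_vanishes_on_ideal:
  assumes sdr: "adjoin_sdr K Op C h p H"
    and S: "\<And>n d x. x \<in> S n d \<Longrightarrow> \<exists>w>0. weight w n d x"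
    and x: "x \<in> generated_dg_ideal K P S n d"
  shows "p n d x = \<zero>\<^bsub>piece Op n d\<^esub>"
proof -
  have S_P: "S n d \<subseteq> elts P n d" for n d
    using S weight_closed by blast
  have p_hom: "dg_operad_hom K P Op p"
    and p_weight: "\<And>w n d x. \<lbrakk>weight w n d x; w > 0\<rbrakk> \<Longrightarrow> p n d x = \<zero>\<^bsub>piece Op n d\<^esub>"
    using sdr by (auto simp: adjoin_sdr_def operad_sdr_def)
  have "S n d \<subseteq> {x \<in> elts P n d. p n d x = \<zero>\<^bsub>piece Op n d\<^esub>}" for n d
    using S S_P p_weight by blast
  from generated_dg_ideal(3)[OF P.dg_operad_axioms S_P
      kernel_dg_ideal[OF P.dg_operad_axioms Op.dg_operad_axioms p_hom] this]
  show ?thesis using x by blast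
qed

text \<open>The heart of the proof.  Let \<open>A\<close> consist of the homogeneous elements \<open>x\<close> of positive weight such
  that \<open>x\<close> and \<open>H x\<close> both lie in the ideal \<open>I\<close>, and let \<open>J\<close> be its span.  Then \<open>J\<close> is a DG ideal
  that contains the generators, so \<open>I\<close> is contained in \<open>J\<close>, and \<open>H\<close> maps \<open>J\<close> into \<open>I\<close>.  That \<open>J\<close> is
  closed under the differential follows from \<open>H (d x) = x - i (p x) - d (H x)\<close> and \<open>p x = 0\<close>; that it
  is closed under composition with homogeneous elements, from the weighted derivation formula for \<open>H\<close>.
  Since this formula is only available for homogeneous arguments, \<open>J\<close> cannot simply be taken as the
  set of all \<open>x\<close> in \<open>I\<close> with \<open>H x\<close> in \<open>I\<close>: the homogeneous parts of such an \<open>x\<close> need not have the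
  same property a priori.\<close>

lemma homotopy_preserves_ideal:
  assumes char: "\<And>n::nat. n > 0 \<Longrightarrow> [n] \<cdot> \<one> \<noteq> \<zero>"
    and sdr: "adjoin_sdr K Op C h p H"
    and S: "\<And>n d x. x \<in> S n d \<Longrightarrow> \<exists>w>0. weight w n d x"
    and I: "I = generated_dg_ideal K P S"
    and H_S: "\<And>n d x. x \<in> S n d \<Longrightarrow> H n d x \<in> I n (d - 1)"
    and x: "x \<in> I n d"
  shows "H n d x \<in> I n (d - 1)"
proof -
  have S_P: "S n d \<subseteq> elts P n d" for n d
    using S weight_closed by blast
  note I_gen = generated_dg_ideal[OF P.dg_operad_axioms S_P, folded I]
  have I_kernel: "p n d x = \<zero>\<^bsub>piece Op n d\<^esub>" if "x \<in> I n d" for n d x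
    using retraction_vanishes_on_ideal[OF sdr S that[unfolded I]] .
  interpret dg_ideal K P I
    by standard (rule I_gen(1))
  have H_maps: "H \<in> graded_maps K P P (-1)"
    and i_hom: "dg_operad_hom K Op P inl"
    and homotopy: "\<And>n d x. x \<in> elts P n d \<Longrightarrow>
      diff P n (d - 1) (H n d x) \<oplus>\<^bsub>piece P n d\<^esub> H n (d + 1) (diff P n d x) =
      x \<ominus>\<^bsub>piece P n d\<^esub> inl n d (p n d x)"
    and H_cmp: "\<And>v w m a n b i x y. \<lbrakk>weight v m a x; weight w n b y; 1 \<le> i; i \<le> m\<rbrakk> \<Longrightarrow>
      H (m + n - 1) (a + b) (cmp P m a n b i x y) =
        weight_ratio K v (v + w) \<odot>\<^bsub>piece P (m + n - 1) (a + b - 1)\<^esub> cmp P m (a - 1) n b i (H m a x) y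
        \<oplus>\<^bsub>piece P (m + n - 1) (a + b - 1)\<^esub>
        (ksign K a \<otimes> weight_ratio K w (v + w)) \<odot>\<^bsub>piece P (m + n - 1) (a + b - 1)\<^esub>
          cmp P m a n (b - 1) i x (H n b y)"
    using sdr by (auto simp: adjoin_sdr_def operad_sdr_def Let_def)
  have H_lin: "H n d \<in> linear_maps K (piece P n d) (piece P n (d - 1))" for n d
    using H_maps by (simp add: graded_maps_def)
  have H_act: "H n d (act P n d \<sigma> x) = act P n (d - 1) \<sigma> (H n d x)"
    if "\<sigma> permutes {1..n}" "x \<in> elts P n d" for n d \<sigma> x
    using H_maps that by (simp add: graded_maps_def equivariant_def)
  have I_add: "x \<oplus>\<^bsub>piece P n d\<^esub> y \<in> I n d" if "x \<in> I n d" "y \<in> I n d" for n d x y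
    using module.submoduleE(5)[OF P.piece_module ideal_submodule that] .
  have I_smult: "c \<odot>\<^bsub>piece P n d\<^esub> x \<in> I n d" if "c \<in> carrier K" "x \<in> I n d" for n d c x
    using module.submoduleE(4)[OF P.piece_module ideal_submodule that] .
  define A where "A n d = {x \<in> I n d. H n d x \<in> I n (d - 1) \<and> (\<exists>w>0. weight w n d x)}" for n d
  define J where "J n d = generate (add_monoid (piece P n d)) (A n d)" for n d
  have A_closed: "A n d \<subseteq> elts P n d" for n d
    unfolding A_def using ideal_carrier by blast
  have incl: "x \<in> J n d" if "x \<in> A n d" for n d x
    unfolding J_def using that by (rule generate.incl)
  have A_smult: "c \<odot>\<^bsub>piece P n d\<^esub> x \<in> A n d" if "c \<in> carrier K" "x \<in> A n d" for n d c x
    using that ideal_carrier by (auto simp: A_def I_smult linear_maps_smult[OF H_lin] intro: weight_smult)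
  have A_act: "act P n d \<sigma> x \<in> A n d" if "\<sigma> permutes {1..n}" "x \<in> A n d" for n d \<sigma> x
    using that ideal_carrier by (auto simp: A_def ideal_act H_act intro: weight_act)
  have A_diff: "diff P n d x \<in> A n (d + 1)" if x: "x \<in> A n d" for n d x
  proof -
    from x have xI: "x \<in> I n d" and HxI: "H n d x \<in> I n (d - 1)" and "\<exists>w>0. weight w n d x"
      by (auto simp: A_def)
    note xP = ideal_carrier[OF xI]
    have dHx: "diff P n (d - 1) (H n d x) \<in> I n d"
      using ideal_diff[OF HxI] by simp
    have Hdx: "H n (d + 1) (diff P n d x) \<in> elts P n d"
      using linear_maps_closed[OF H_lin linear_maps_closed[OF P.diff_linear xP]] by simp
    have "diff P n (d - 1) (H n d x) \<oplus>\<^bsub>piece P n d\<^esub> H n (d + 1) (diff P n d x) = x"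
      using homotopy[OF xP] xP
      by (simp add: I_kernel[OF xI] linear_maps_zero[OF Op.piece_module P.piece_module dg_operad_homD(1)[OF i_hom]]
          module_minus_zero[OF P.piece_module])
    then have "H n (d + 1) (diff P n d x) = x \<ominus>\<^bsub>piece P n d\<^esub> diff P n (d - 1) (H n d x)"
      using module_add_minus_cancel[OF P.piece_module ideal_carrier[OF dHx] Hdx] by simp
    also have "\<dots> \<in> I n d"
      using xI dHx by (rule submodule_minus[OF P.piece_module ideal_submodule])
    finally show ?thesis
      using ideal_diff[OF xI] \<open>\<exists>w>0. _\<close> weight_diff by (auto simp: A_def)
  qed
  \<comment> \<open>One of the factors lies in \<open>A\<close>, so the total weight is positive.\<close>
  have A_cmp: "cmp P m a n b i x y \<in> A (m + n - 1) (a + b)"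
    if i: "1 \<le> i" "i \<le> m" and xy: "x \<in> A m a \<and> y \<in> homogeneous n b \<or> x \<in> homogeneous m a \<and> y \<in> A n b"
    for m n a b i x y
  proof -
    obtain v w where vw: "weight v m a x" "weight w n b y" "v + w > 0"
      using xy by (auto simp: A_def)
    note xP = weight_closed[OF vw(1)] and yP = weight_closed[OF vw(2)]
    note HxP = linear_maps_closed[OF H_lin xP] and HyP = linear_maps_closed[OF H_lin yP]
    have e: "a - 1 + b = a + b - 1" "a + (b - 1) = a + b - 1" by auto
    have 1: "cmp P m a n b i x y \<in> I (m + n - 1) (a + b)"
      using xy ideal_cmp_left[OF i _ yP] ideal_cmp_right[OF i xP] by (auto simp: A_def)
    have 2: "cmp P m (a - 1) n b i (H m a x) y \<in> I (m + n - 1) (a + b - 1)"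
      using xy ideal_cmp_left[OF i _ yP, of "H m a x" "a - 1"] ideal_cmp_right[OF i HxP, of y n b]
      unfolding e by (auto simp: A_def)
    have 3: "cmp P m a n (b - 1) i x (H n b y) \<in> I (m + n - 1) (a + b - 1)"
      using xy ideal_cmp_left[OF i _ HyP, of x a] ideal_cmp_right[OF i xP, of "H n b y" n "b - 1"]
      unfolding e by (auto simp: A_def)
    have "H (m + n - 1) (a + b) (cmp P m a n b i x y) \<in> I (m + n - 1) (a + b - 1)"
      unfolding H_cmp[OF vw(1,2) i]
      by (intro I_add I_smult 2 3 weight_ratio_closed[OF char] Op.m_closed Op.ksign_closed)
    then show ?thesis
      using 1 weight_cmp[OF i vw(1,2)] vw(3) by (auto simp: A_def)
  qed
  have J_sub: "submodule (J n d) K (piece P n d)" for n d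
    unfolding J_def by (rule submodule_generate[OF P.piece_module A_closed A_smult])
  have J_act: "act P n d \<sigma> x \<in> J n d" if "\<sigma> permutes {1..n}" "x \<in> J n d" for n d \<sigma> x
    by (rule linear_image_generate[OF P.piece_module P.piece_module P.act_linear[OF that(1)] J_sub
          A_closed incl[OF A_act[OF that(1)]] that(2)[unfolded J_def]])
  have J_diff: "diff P n d x \<in> J n (d + 1)" if "x \<in> J n d" for n d x
    by (rule linear_image_generate[OF P.piece_module P.piece_module P.diff_linear J_sub
          A_closed incl[OF A_diff] that[unfolded J_def]])
  have J_left: "cmp P m a n b i x y \<in> J (m + n - 1) (a + b)"
    if "1 \<le> i" "i \<le> m" "x \<in> J m a" "y \<in> elts P n b" for m n a b i x y
    by (rule P.cmp_generate[OF that(1,2) A_closed homogeneous_closed J_sub incl[OF A_cmp[OF that(1,2)]]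
          that(3)[unfolded J_def] homogeneous_span[OF that(4)]]) auto
  have J_right: "cmp P m a n b i x y \<in> J (m + n - 1) (a + b)"
    if "1 \<le> i" "i \<le> m" "x \<in> elts P m a" "y \<in> J n b" for m n a b i x y
    by (rule P.cmp_generate[OF that(1,2) homogeneous_closed A_closed J_sub incl[OF A_cmp[OF that(1,2)]]
          homogeneous_span[OF that(3)] that(4)[unfolded J_def]]) auto
  have "dg_operadic_ideal K P J"
    unfolding dg_operadic_ideal_def using J_sub J_act J_diff J_left J_right by simp
  moreover have "S n d \<subseteq> J n d" for n d
    using S H_S subsetD[OF I_gen(2)] by (auto intro!: incl simp: A_def)
  ultimately have "x \<in> J n d"
    using I_gen(3) x by blast
  then show ?thesis
    unfolding J_def
    by (rule linear_image_generate[OF P.piece_module P.piece_module H_lin ideal_submodule A_closed, rotated])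
      (simp add: A_def)
qed

end

theorem theorem3p11:
  fixes K :: "('k, 'r) ring_scheme"
    and Op :: "('k, 'o) operad"
    and C :: "('k, 'c) smodule"
    and h :: "nat \<Rightarrow> int \<Rightarrow> 'c \<Rightarrow> 'c"
    and p :: "nat \<Rightarrow> int \<Rightarrow> ('k, 'o + ('k, 'c) opterm set) opterm set \<Rightarrow> 'o"
    and hC :: "nat \<Rightarrow> int \<Rightarrow> ('k, 'o + ('k, 'c) opterm set) opterm set \<Rightarrow>
                ('k, 'o + ('k, 'c) opterm set) opterm set"
    and S I :: "nat \<Rightarrow> int \<Rightarrow> ('k, 'o + ('k, 'c) opterm set) opterm set set"
  defines "P \<equiv> adjoin K Op C"
  assumes "field K" and "\<And>n::nat. n > 0 \<Longrightarrow> add_pow K n \<one>\<^bsub>K\<^esub> \<noteq> \<zero>\<^bsub>K\<^esub>"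
    and "dg_operad K Op"
    and "dg_smodule K C"
    and "smodule_contraction K C h"
    and "adjoin_sdr K Op C h p hC"
    and "\<And>n d x. x \<in> S n d \<Longrightarrow> \<exists>w>0. has_weight K Op C w n d x"
    and "I = generated_dg_ideal K P S"
    and "\<And>n d x. x \<in> S n d \<Longrightarrow> hC n d x \<in> I n (d - 1)"
  shows "operad_quasi_iso K Op (quot_operad P I) (\<lambda>n d x. quot_proj P I n d (adjoin_inl K Op C n d x))"
proof -
  interpret A: adjoined_operad K Op C
    using assms(4,5) by (simp add: adjoined_operad_def)
  have S_P: "S n d \<subseteq> elts A.P n d" for n d
    using assms(8) A.weight_closed by blast
  have I: "I = generated_dg_ideal K A.P S"
    using assms(9) by (simp add: P_def)
  have p_I: "p n d x = \<zero>\<^bsub>piece Op n d\<^esub>" if "x \<in> I n d" for n d x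
    using A.retraction_vanishes_on_ideal[OF assms(7,8) that[unfolded I]] .
  have hC_I: "hC n d x \<in> I n (d - 1)" if "x \<in> I n d" for n d x
    by (rule A.homotopy_preserves_ideal[OF _ assms(7,8) I assms(10) that]) (rule assms(3))
  interpret dg_ideal K A.P I
    unfolding I by (intro dg_ideal.intro dg_ideal_axioms.intro A.P.dg_operad_axioms
        generated_dg_ideal(1)[OF A.P.dg_operad_axioms S_P])
  have "operad_sdr K A.P Op (adjoin_inl K Op C) p hC"
    using assms(7) by (simp add: adjoin_sdr_def)
  from sdr_quotient_quasi_iso[OF assms(4) this p_I hC_I] show ?thesis
    by (simp add: P_def)
qed

end
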